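(* 1. Let $u=\alpha v_n\in A_1$ where $0\neq n\in\mathbb{Z}$ and $\alpha$ is a monic polynomial of $K[H]$. Then $C(u,A_1)=\bigoplus_{i=0}^{m-1}K[u]v^{\mu_i}$. 2. Let $u\in K[H]\setminus K$. Then $C(u,A_1)=K[H]$.
   Context: $K$ is a field of characteristic zero. $A_1$ is the first Weyl algebra over $K$, generated by $X,Y$ with $YX-XY=1$, and $H=YX$. Put $v_n=X^n$ for $n>0$, $v_n=Y^{-n}$ for $n<0$, $v_0=1$; then $A_1=\bigoplus_{i\in\mathbb{Z}}K[H]v_i$ is $\mathbb{Z}$-graded. Let $\sigma$ be the $K$-automorphism of $K(H)$ with $\sigma(H)=H-1$ and $B=K(H)[X,X^{-1};\sigma]$ the skew Laurent polynomial ring with $Xf=\sigma(f)X$ for $f\in K(H)$. $A_1$ is identified with a subalgebra of $B$ via $X\mapsto X$, $Y\mapsto HX^{-1}$. For an algebra $R\in\{A_1,B\}$ and $u\in R$, $C(u,R)$ is the centralizer of $u$ in $R$. An element of $K(H)$ is monic if it is a quotient of two polynomials with leading coefficient $1$; a homogeneous element $fX^n\in B$ is monic if $f$ is. Let $u=\alpha v_n$ be as in part 1. In $B$, $u=\alpha'X^n$ is a monic homogeneous element. Let $s$ be the minimal positive divisor of $n$ for which, with $t=\mathrm{sign}(n)s$, there exists a monic $\beta\in K(H)$ (then unique) with $\beta\,\sigma^{t}(\beta)\cdots\sigma^{(n/t-1)t}(\beta)=\alpha'$. The canonical generator of $C(u,B)$ is $v=\beta X^{t}$; one has $C(u,B)=K[v,v^{-1}]$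 and $v^m=u$ with $m=n/t\geq 1$. For $i=0,1,\ldots,m-1$ set $$\mu_i=\min\{j\geq 0\mid v^j\in A_1,\ j\equiv i\ (\mathrm{mod}\ m)\}$$ (these sets are non-empty). *)

theory Defs
  imports Complex_Main
    "HOL-Computational_Algebra.Polynomial_Factorial"
    "HOL-Number_Theory.Cong"
begin

section \<open>The field \<open>K(H)\<close> and its shift automorphism\<close>

text \<open>
  \<open>K(H)\<close> is the type \<^typ>\<open>'a poly fract\<close> for a field \<^typ>\<open>'a\<close>; the polynomial variable \<open>[:0, 1:]\<close>
  plays the role of \<open>H\<close>. The function \<open>sigma k\<close> is the integer power \<open>\<sigma>\<^sup>k\<close> of the
  \<open>K\<close>-automorphism \<open>\<sigma>\<close> given by \<open>\<sigma>(H) = H - 1\<close>, that is, the substitution of \<open>H - k\<close> for \<open>H\<close>.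
\<close>

definition shift_poly :: "int \<Rightarrow> 'a::field poly \<Rightarrow> 'a poly" where
  "shift_poly k p = pcompose p [:- of_int k, 1:]"

lemma shift_poly_0_iff [simp]: "shift_poly k p = 0 \<longleftrightarrow> p = 0"
  unfolding shift_poly_def by (rule pcompose_eq_0_iff) simp

lemma shift_poly_mult: "shift_poly k (p * q) = shift_poly k p * shift_poly k q"
  by (simp add: shift_poly_def pcompose_mult)

lemma shift_poly_add: "shift_poly k (p + q) = shift_poly k p + shift_poly k q"
  by (simp add: shift_poly_def pcompose_add)

lemma shift_poly_1 [simp]: "shift_poly k 1 = 1"
  by (simp add: shift_poly_def pcompose_1)

lemma shift_poly_id [simp]: "shift_poly 0 p = p"
  by (simp add: shift_poly_def)

lemma shift_poly_shift_poly: "shift_poly k (shift_poly l p) = shift_poly (k + l) p"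
  by (simp add: shift_poly_def pcompose_assoc [symmetric] pcompose_pCons algebra_simps)

definition sigma :: "int \<Rightarrow> 'a::field poly fract \<Rightarrow> 'a poly fract" where
  "sigma k f = (THE g. \<exists>p q. q \<noteq> 0 \<and> f = Fract p q \<and> g = Fract (shift_poly k p) (shift_poly k q))"

lemma sigma_Fract: "sigma k (Fract p q) = Fract (shift_poly k p) (shift_poly k q)"
proof -
  have *: "sigma k (Fract p q) = Fract (shift_poly k p) (shift_poly k q)" if "q \<noteq> 0" for p q
    unfolding sigma_def
    by (rule the_equality) (use that in \<open>auto simp: eq_fract simp flip: shift_poly_mult\<close>)
  show ?thesis
  proof (cases "q = 0")
    case True
    have "Fract p 0 = Fract 0 1" "Fract (shift_poly k p) 0 = Fract 0 1"
      by (simp_all add: eq_fract)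
    with True *[of 1 0] show ?thesis by (simp add: shift_poly_def pcompose_1)
  qed (use * in blast)
qed

lemma sigma_to_fract: "sigma k (to_fract p) = to_fract (shift_poly k p)"
  by (simp add: to_fract_def sigma_Fract)

lemma sigma_one_H: "sigma 1 (to_fract [:0, 1:]) = to_fract [:0, 1:] - (1 :: 'a::field poly fract)"
proof -
  have "shift_poly 1 [:0, 1:] = [:0, 1:] - (1 :: 'a poly)"
    by (simp add: shift_poly_def pcompose_pCons one_pCons)
  then show ?thesis by (simp add: sigma_to_fract)
qed

lemma sigma_const [simp]: "sigma k (to_fract [:c:]) = to_fract [:c:]"
  by (simp add: sigma_to_fract shift_poly_def)

lemma sigma_0 [simp]: "sigma k 0 = 0"
  using sigma_to_fract [of k 0] by (simp add: shift_poly_def)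

lemma sigma_1 [simp]: "sigma k 1 = 1"
  using sigma_to_fract [of k 1] by simp

lemma sigma_id [simp]: "sigma 0 f = f"
  by (cases f) (simp add: sigma_Fract)

lemma sigma_sigma: "sigma k (sigma l f) = sigma (k + l) f"
  by (cases f) (simp add: sigma_Fract shift_poly_shift_poly)

lemma sigma_mult: "sigma k (f * g) = sigma k f * sigma k g"
  by (cases f; cases g) (simp add: sigma_Fract shift_poly_mult)

lemma sigma_add: "sigma k (f + g) = sigma k f + sigma k g"
  by (cases f; cases g) (simp add: sigma_Fract shift_poly_mult shift_poly_add)

lemma sigma_sum: "sigma k (sum f A) = (\<Sum>x\<in>A. sigma k (f x))"
  by (induction A rule: infinite_finite_induct) (simp_all add: sigma_add)

definition monic_fract :: "'a::field poly fract \<Rightarrow> bool" where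
  "monic_fract f \<longleftrightarrow> (\<exists>p q. lead_coeff p = 1 \<and> lead_coeff q = 1 \<and> f = Fract p q)"


section \<open>The skew Laurent polynomial ring \<open>B = K(H)[X, X\<^sup>-\<^sup>1; \<sigma>]\<close>\<close>

text \<open>
  An element \<open>\<Sum>\<^sub>n f\<^sub>n X\<^sup>n\<close> (coefficients on the left) is represented by its finitely supported
  coefficient function; the product is determined by \<open>f X\<^sup>i \<cdot> g X\<^sup>j = f \<sigma>\<^sup>i(g) X\<^sup>i\<^sup>+\<^sup>j\<close>.
\<close>

typedef (overloaded) 'a skew_laurent =
  "{f :: int \<Rightarrow> 'a::field poly fract. finite {n. f n \<noteq> 0}}"
  morphisms sl_coeff Abs_skew_laurent
  by (rule exI [of _ "\<lambda>_. 0"]) simp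

setup_lifting type_definition_skew_laurent

lemma finite_sl_coeff [simp]: "finite {n. sl_coeff f n \<noteq> 0}"
  using sl_coeff [of f] by simp

lemma sl_eqI: "(\<And>n. sl_coeff f n = sl_coeff g n) \<Longrightarrow> f = g"
  by (simp add: sl_coeff_inject [symmetric] fun_eq_iff)

instantiation skew_laurent :: (field) ring_1
begin

lift_definition zero_skew_laurent :: "'a skew_laurent" is "\<lambda>_. 0"
  by simp

lift_definition one_skew_laurent :: "'a skew_laurent" is "\<lambda>n. if n = 0 then 1 else 0"
  by simp

lift_definition plus_skew_laurent :: "'a skew_laurent \<Rightarrow> 'a skew_laurent \<Rightarrow> 'a skew_laurent"
  is "\<lambda>f g n. f n + g n"
proof -
  fix f g :: "int \<Rightarrow> 'a poly fract"
  assume "finite {n. f n \<noteq> 0}" "finite {n. g n \<noteq> 0}"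
  then show "finite {n. f n + g n \<noteq> 0}"
    by (rule_tac finite_subset [of _ "{n. f n \<noteq> 0} \<union> {n. g n \<noteq> 0}"]) auto
qed

lift_definition uminus_skew_laurent :: "'a skew_laurent \<Rightarrow> 'a skew_laurent"
  is "\<lambda>f n. - f n"
  by simp

lift_definition minus_skew_laurent :: "'a skew_laurent \<Rightarrow> 'a skew_laurent \<Rightarrow> 'a skew_laurent"
  is "\<lambda>f g n. f n - g n"
proof -
  fix f g :: "int \<Rightarrow> 'a poly fract"
  assume "finite {n. f n \<noteq> 0}" "finite {n. g n \<noteq> 0}"
  then show "finite {n. f n - g n \<noteq> 0}"
    by (rule_tac finite_subset [of _ "{n. f n \<noteq> 0} \<union> {n. g n \<noteq> 0}"]) auto
qed

lift_definition times_skew_laurent :: "'a skew_laurent \<Rightarrow> 'a skew_laurent \<Rightarrow> 'a skew_laurent"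
  is "\<lambda>f g n. \<Sum>i\<in>{i. f i \<noteq> 0}. f i * sigma i (g (n - i))"
proof -
  fix f g :: "int \<Rightarrow> 'a poly fract"
  assume fin: "finite {n. f n \<noteq> 0}" "finite {n. g n \<noteq> 0}"
  have "{n. (\<Sum>i\<in>{i. f i \<noteq> 0}. f i * sigma i (g (n - i))) \<noteq> 0}
      \<subseteq> (\<lambda>(i, j). i + j) ` ({n. f n \<noteq> 0} \<times> {n. g n \<noteq> 0})"
  proof
    fix n
    assume "n \<in> {n. (\<Sum>i\<in>{i. f i \<noteq> 0}. f i * sigma i (g (n - i))) \<noteq> 0}"
    then obtain i where "f i \<noteq> 0" "f i * sigma i (g (n - i)) \<noteq> 0"
      by (auto elim!: sum.not_neutral_contains_not_neutral)
    then have "f i \<noteq> 0" "g (n - i) \<noteq> 0" by auto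
    then show "n \<in> (\<lambda>(i, j). i + j) ` ({n. f n \<noteq> 0} \<times> {n. g n \<noteq> 0})"
      by (intro image_eqI [of _ _ "(i, n - i)"]) auto
  qed
  then show "finite {n. (\<Sum>i\<in>{i. f i \<noteq> 0}. f i * sigma i (g (n - i))) \<noteq> 0}"
    by (rule finite_subset) (use fin in auto)
qed

lemma sl_coeff_times:
  assumes "finite S" "{i. sl_coeff f i \<noteq> 0} \<subseteq> S"
  shows "sl_coeff (f * g) n = (\<Sum>i\<in>S. sl_coeff f i * sigma i (sl_coeff g (n - i)))"
  unfolding times_skew_laurent.rep_eq
  by (rule sum.mono_neutral_left) (use assms in auto)

instance
proof
  fix f g h :: "'a skew_laurent"
  show "f + g + h = f + (g + h)" by transfer (simp add: add.assoc)
  show "f + g = g + f" by transfer (simp add: add.commute)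
  show "0 + f = f" by transfer simp
  show "- f + f = 0" by transfer simp
  show "f - g = f + - g" by transfer simp
  show "(0 :: 'a skew_laurent) \<noteq> 1" by transfer (auto simp: fun_eq_iff)
  show "1 * f = f"
  proof (rule sl_eqI)
    fix n
    show "sl_coeff (1 * f) n = sl_coeff f n"
      by (subst sl_coeff_times [of "{0}"]) (auto simp: one_skew_laurent.rep_eq)
  qed
  show "f * 1 = f"
  proof (rule sl_eqI)
    fix n
    have "sl_coeff (f * 1) n
        = (\<Sum>i\<in>insert n {i. sl_coeff f i \<noteq> 0}. sl_coeff f i * sigma i (if n - i = 0 then 1 else 0))"
      by (subst sl_coeff_times [of "insert n {i. sl_coeff f i \<noteq> 0}"])
        (auto simp: one_skew_laurent.rep_eq)
    also have "\<dots> = (\<Sum>i\<in>insert n {i. sl_coeff f i \<noteq> 0}. if i = n then sl_coeff f i else 0)"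
      by (rule sum.cong) auto
    also have "\<dots> = sl_coeff f n" by (subst sum.delta) auto
    finally show "sl_coeff (f * 1) n = sl_coeff f n" .
  qed
  show "(f + g) * h = f * h + g * h"
  proof (rule sl_eqI)
    fix n
    let ?S = "{i. sl_coeff f i \<noteq> 0} \<union> {i. sl_coeff g i \<noteq> 0}"
    have "sl_coeff (f * h) n = (\<Sum>i\<in>?S. sl_coeff f i * sigma i (sl_coeff h (n - i)))"
      "sl_coeff (g * h) n = (\<Sum>i\<in>?S. sl_coeff g i * sigma i (sl_coeff h (n - i)))"
      "sl_coeff ((f + g) * h) n = (\<Sum>i\<in>?S. sl_coeff (f + g) i * sigma i (sl_coeff h (n - i)))"
      by (rule sl_coeff_times; auto simp: plus_skew_laurent.rep_eq)+
    then show "sl_coeff ((f + g) * h) n = sl_coeff (f * h + g * h) n"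
      by (simp add: plus_skew_laurent.rep_eq sum.distrib algebra_simps)
  qed
  show "f * (g + h) = f * g + f * h"
    by (rule sl_eqI)
      (simp add: times_skew_laurent.rep_eq plus_skew_laurent.rep_eq sigma_add
        sum.distrib distrib_left)
  show "f * g * h = f * (g * h)"
  proof (rule sl_eqI)
    fix n
    let ?F = "{i. sl_coeff f i \<noteq> 0}" and ?G = "{i. sl_coeff g i \<noteq> 0}"
    define S where "S = {i. sl_coeff (f * g) i \<noteq> 0} \<union> (\<lambda>(i, j). i + j) ` (?F \<times> ?G)"
    have S: "finite S" "{i. sl_coeff (f * g) i \<noteq> 0} \<subseteq> S" by (auto simp: S_def)
    have inner: "(\<Sum>k\<in>S. sigma i (sl_coeff g (k - i)) * sigma k (sl_coeff h (n - k)))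
        = sigma i (sl_coeff (g * h) (n - i))" if "i \<in> ?F" for i
    proof -
      let ?T = "(\<lambda>k. k - i) ` S"
      have "?G \<subseteq> ?T"
      proof
        fix j assume "j \<in> ?G"
        with that have "i + j \<in> S" by (auto simp: S_def intro!: image_eqI [of _ _ "(i, j)"])
        then show "j \<in> ?T" by (intro image_eqI [of _ _ "i + j"]) auto
      qed
      then have "sl_coeff (g * h) (n - i)
          = (\<Sum>j\<in>?T. sl_coeff g j * sigma j (sl_coeff h (n - i - j)))"
        using S by (intro sl_coeff_times) auto
      also have "\<dots> = (\<Sum>k\<in>S. sl_coeff g (k - i) * sigma (k - i) (sl_coeff h (n - k)))"
        by (subst sum.reindex) (auto simp: inj_on_def)
      finally show ?thesis
        by (simp add: sigma_sum sigma_mult sigma_sigma)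
    qed
    have "sl_coeff (f * g * h) n
        = (\<Sum>k\<in>S. \<Sum>i\<in>?F. sl_coeff f i * (sigma i (sl_coeff g (k - i)) * sigma k (sl_coeff h (n - k))))"
      by (subst sl_coeff_times [OF S])
        (simp add: times_skew_laurent.rep_eq sum_distrib_right mult.assoc)
    also have "\<dots> = (\<Sum>i\<in>?F. sl_coeff f i *
        (\<Sum>k\<in>S. sigma i (sl_coeff g (k - i)) * sigma k (sl_coeff h (n - k))))"
      by (subst sum.swap) (simp add: sum_distrib_left)
    also have "\<dots> = sl_coeff (f * (g * h)) n"
      by (simp add: inner times_skew_laurent.rep_eq [of f])
    finally show "sl_coeff (f * g * h) n = sl_coeff (f * (g * h)) n" .
  qed
qed

end

text \<open>\<open>sl_monom f n\<close> is the homogeneous element \<open>f X\<^sup>n\<close>.\<close>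

definition sl_monom :: "'a::field poly fract \<Rightarrow> int \<Rightarrow> 'a skew_laurent" where
  "sl_monom f n = Abs_skew_laurent (\<lambda>k. if k = n then f else 0)"

lemma sl_coeff_monom: "sl_coeff (sl_monom f n) k = (if k = n then f else 0)"
proof -
  have "finite {k. (if k = n then f else 0) \<noteq> 0}"
    by (rule finite_subset [of _ "{n}"]) auto
  then show ?thesis by (simp add: sl_monom_def Abs_skew_laurent_inverse)
qed

lemma sl_monom_mult: "sl_monom f i * sl_monom g j = sl_monom (f * sigma i g) (i + j)"
proof (rule sl_eqI)
  fix n
  show "sl_coeff (sl_monom f i * sl_monom g j) n = sl_coeff (sl_monom (f * sigma i g) (i + j)) n"
    by (subst sl_coeff_times [of "{i}"]) (auto simp: sl_coeff_monom)
qed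

lemma sl_monom_1_0: "sl_monom 1 0 = 1"
  by (rule sl_eqI) (simp add: sl_coeff_monom one_skew_laurent.rep_eq)

lemma sl_monom_0 [simp]: "sl_monom 0 n = 0"
  by (rule sl_eqI) (simp add: sl_coeff_monom zero_skew_laurent.rep_eq)

lemma sl_monom_add: "sl_monom f n + sl_monom g n = sl_monom (f + g) n"
  by (rule sl_eqI) (simp add: sl_coeff_monom plus_skew_laurent.rep_eq)

lemma sl_monom_diff: "sl_monom f n - sl_monom g n = sl_monom (f - g) n"
  by (rule sl_eqI) (simp add: sl_coeff_monom minus_skew_laurent.rep_eq)


section \<open>Subalgebras and centralizers\<close>

definition sl_const :: "'a::field \<Rightarrow> 'a skew_laurent" where
  "sl_const c = sl_monom (to_fract [:c:]) 0"

lemma sl_const_central: "sl_const c * w = w * sl_const c"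
proof (rule sl_eqI)
  fix n
  let ?S = "insert n {i. sl_coeff w i \<noteq> 0}"
  have "sl_coeff (w * sl_const c) n
      = (\<Sum>i\<in>?S. sl_coeff w i * sigma i (if n - i = 0 then to_fract [:c:] else 0))"
    by (subst sl_coeff_times [of ?S]) (auto simp: sl_const_def sl_coeff_monom)
  also have "\<dots> = (\<Sum>i\<in>?S. if i = n then sl_coeff w i * to_fract [:c:] else 0)"
    by (rule sum.cong) auto
  also have "\<dots> = sl_coeff w n * to_fract [:c:]" by (subst sum.delta) auto
  also have "\<dots> = sl_coeff (sl_const c * w) n"
    by (subst sl_coeff_times [of "{0}"]) (auto simp: sl_const_def sl_coeff_monom mult.commute)
  finally show "sl_coeff (sl_const c * w) n = sl_coeff (w * sl_const c) n" by simp
qed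

text \<open>The unital \<open>K\<close>-subalgebra \<open>K\<langle>S\<rangle>\<close> of \<open>B\<close> generated by \<open>S\<close>; for \<open>S = {u}\<close> it is \<open>K[u]\<close>.\<close>

inductive_set subalg :: "'a::field skew_laurent set \<Rightarrow> 'a skew_laurent set"
  for S :: "'a skew_laurent set"
where
  gen: "x \<in> S \<Longrightarrow> x \<in> subalg S"
| const: "sl_const c \<in> subalg S"
| add: "x \<in> subalg S \<Longrightarrow> y \<in> subalg S \<Longrightarrow> x + y \<in> subalg S"
| mult: "x \<in> subalg S \<Longrightarrow> y \<in> subalg S \<Longrightarrow> x * y \<in> subalg S"

definition centralizer :: "'b::ring_1 \<Rightarrow> 'b set \<Rightarrow> 'b set" where
  "centralizer u R = {w \<in> R. w * u = u * w}"

definition internal_direct_sum :: "'i set \<Rightarrow> ('i \<Rightarrow> 'b::ab_group_add set) \<Rightarrow> 'b set \<Rightarrow> bool" where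
  "internal_direct_sum I M C \<longleftrightarrow>
     C = {\<Sum>i\<in>I. f i | f. \<forall>i\<in>I. f i \<in> M i} \<and>
     (\<forall>f. (\<forall>i\<in>I. f i \<in> M i) \<and> (\<Sum>i\<in>I. f i) = 0 \<longrightarrow> (\<forall>i\<in>I. f i = 0))"


section \<open>The first Weyl algebra inside \<open>B\<close>\<close>

text \<open>
  The Weyl algebra is taken as its image in \<open>B\<close> under \<open>X \<mapsto> X\<close>, \<open>Y \<mapsto> H X\<^sup>-\<^sup>1\<close>. The lemmas
  \<open>weyl_relation\<close> and \<open>weyl_monomials_independent\<close> below show that the generators satisfy the
  defining relation and that the monomials \<open>X\<^sup>i Y\<^sup>j\<close> are linearly
  independent, so this image is a faithful copy of \<open>K\<langle>X, Y\<rangle> / (Y X - X Y - 1)\<close>.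
\<close>

definition wX :: "'a::field skew_laurent" where
  "wX = sl_monom 1 1"

definition wY :: "'a::field skew_laurent" where
  "wY = sl_monom (to_fract [:0, 1:]) (- 1)"

definition wH :: "'a::field skew_laurent" where
  "wH = wY * wX"

definition weyl :: "'a::field skew_laurent set" where
  "weyl = subalg {wX, wY}"

definition wv :: "int \<Rightarrow> 'a::field skew_laurent" where
  "wv n = (if n > 0 then wX ^ nat n else if n < 0 then wY ^ nat (- n) else 1)"

text \<open>\<open>hpoly p\<close> is the polynomial \<open>p(H)\<close>, regarded as an element of degree zero in \<open>B\<close>.\<close>

definition hpoly :: "'a::field poly \<Rightarrow> 'a skew_laurent" where
  "hpoly p = sl_monom (to_fract p) 0"

lemma wH_eq: "wH = hpoly [:0, 1:]"
  by (simp add: wH_def wX_def wY_def hpoly_def sl_monom_mult)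

lemma weyl_relation: "wY * wX - wX * wY = 1"
  by (simp add: wX_def wY_def sl_monom_mult sigma_one_H sl_monom_diff sl_monom_1_0)

lemma hpoly_add: "hpoly (p + q) = hpoly p + hpoly q"
  by (simp add: hpoly_def sl_monom_add)

lemma hpoly_mult: "hpoly (p * q) = hpoly p * hpoly q"
  by (simp add: hpoly_def sl_monom_mult)

lemma subalg_wH: "subalg {wH} = range hpoly"
proof (intro set_eqI iffI)
  fix x :: "'a skew_laurent"
  assume "x \<in> subalg {wH}"
  then show "x \<in> range hpoly"
  proof induction
    case (add x y)
    then show ?case by (auto simp flip: hpoly_add)
  next
    case (mult x y)
    then show ?case by (auto simp flip: hpoly_mult)
  qed (auto simp: wH_eq sl_const_def hpoly_def)
next
  fix x :: "'a skew_laurent"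
  assume "x \<in> range hpoly"
  then obtain p where "x = hpoly p" by auto
  moreover have "hpoly p \<in> subalg {wH}"
  proof (induction p)
    case 0
    then show ?case using subalg.const [of 0 "{wH}"] by (simp add: sl_const_def hpoly_def)
  next
    case (pCons a p)
    have "hpoly (pCons a p) = sl_const a + wH * hpoly p"
      by (simp add: wH_eq sl_const_def hpoly_def [of "[:a:]", symmetric]
          flip: hpoly_mult hpoly_add)
    with pCons show ?case by (auto intro: subalg.intros)
  qed
  ultimately show "x \<in> subalg {wH}" by simp
qed

lemma wX_power: "wX ^ i = sl_monom 1 (int i)"
  by (induction i) (auto simp: wX_def sl_monom_mult sl_monom_1_0)

lemma wY_power:
  "\<exists>p :: 'a::field poly. degree p = j \<and> lead_coeff p = 1 \<and> wY ^ j = sl_monom (to_fract p) (- int j)"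
proof (induction j)
  case 0
  show ?case by (rule exI [of _ 1]) (simp add: sl_monom_1_0)
next
  case (Suc j)
  then obtain p :: "'a poly" where p: "degree p = j" "lead_coeff p = 1"
    "wY ^ j = sl_monom (to_fract p) (- int j)" by blast
  let ?q = "shift_poly (- 1) p"
  have q: "degree ?q = j" "lead_coeff ?q = 1"
    using p lead_coeff_comp [of "[:- of_int (- 1), 1:]" p]
    by (simp_all add: shift_poly_def degree_pcompose)
  have "wY ^ Suc j = sl_monom (to_fract ([:0, 1:] * ?q)) (- int (Suc j))"
    unfolding power_Suc p(3) unfolding wY_def sl_monom_mult sigma_to_fract to_fract_mult by simp
  moreover have "?q \<noteq> 0" using q by (metis coeff_0 zero_neq_one)
  then have "degree ([:0, 1:] * ?q) = Suc j" "lead_coeff ([:0, 1:] * ?q) = 1"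
    using q by (simp_all add: degree_mult_eq lead_coeff_mult)
  ultimately show ?case by metis
qed

lemma weyl_monomials_independent:
  fixes c :: "nat \<times> nat \<Rightarrow> 'a::field"
  assumes fin: "finite S" and zero: "(\<Sum>(i, j)\<in>S. sl_const (c (i, j)) * wX ^ i * wY ^ j) = 0"
    and ij: "(i, j) \<in> S"
  shows "c (i, j) = 0"
proof (rule ccontr)
  assume nz: "c (i, j) \<noteq> 0"
  obtain P :: "nat \<Rightarrow> 'a poly" where P: "\<And>j. degree (P j) = j" "\<And>j. lead_coeff (P j) = 1"
    "\<And>j. wY ^ j = sl_monom (to_fract (P j)) (- int j)"
    using wY_power by metis
  define Q where "Q = (\<lambda>(i, j). smult (c (i, j)) (shift_poly (int i) (P j)))"
  have Q: "sl_const (c (i, j)) * wX ^ i * wY ^ j = sl_monom (to_fract (Q (i, j))) (int i - int j)"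
    for i j
    by (simp add: sl_const_def wX_power P(3) sl_monom_mult sigma_to_fract Q_def
        flip: to_fract_mult)
  have coeff: "coeff (Q (i, j)) j = c (i, j)" for i j
  proof -
    have "coeff (shift_poly (int i) (P j)) j = 1"
      using P(1)[of j] P(2)[of j] lead_coeff_comp [of "[:- of_int (int i), 1:]" "P j"]
      by (simp add: shift_poly_def degree_pcompose)
    then show ?thesis by (simp add: Q_def)
  qed
  have coeff0: "coeff (Q (i, j)) k = 0" if "j < k" for i j k
    using that P(1)[of j] by (simp add: Q_def shift_poly_def degree_pcompose coeff_eq_0)
  define d where "d = int i - int j"
  define T where "T = {x \<in> S. int (fst x) - int (snd x) = d \<and> c x \<noteq> 0}"
  define J where "J = Max (snd ` T)"
  have T: "finite T" "(i, j) \<in> T" using fin ij nz by (auto simp: T_def d_def)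
  have J: "J \<in> snd ` T" unfolding J_def using T by (intro Max_in) auto
  then obtain I where IJ: "(I, J) \<in> T" by auto
  have "0 = sl_coeff (\<Sum>(i, j)\<in>S. sl_const (c (i, j)) * wX ^ i * wY ^ j) d"
    by (simp add: zero zero_skew_laurent.rep_eq)
  also have "\<dots> = (\<Sum>x\<in>S. sl_coeff (sl_monom (to_fract (Q x)) (int (fst x) - int (snd x))) d)"
    using fin by (induction S rule: finite_induct)
      (auto simp: zero_skew_laurent.rep_eq plus_skew_laurent.rep_eq Q)
  also have "\<dots> = (\<Sum>x\<in>T. to_fract (Q x))"
  proof (rule sum.mono_neutral_cong_right)
    show "\<forall>x\<in>S - T. sl_coeff (sl_monom (to_fract (Q x)) (int (fst x) - int (snd x))) d = 0"
      by (auto simp: T_def sl_coeff_monom Q_def)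
  qed (use fin in \<open>auto simp: T_def sl_coeff_monom\<close>)
  finally have "(\<Sum>x\<in>T. Q x) = 0"
    by (simp flip: to_fract_sum)
  then have "0 = (\<Sum>x\<in>T. coeff (Q x) J)"
    by (simp flip: coeff_sum)
  also have "\<dots> = (\<Sum>x\<in>{(I, J)}. coeff (Q x) J)"
  proof (rule sum.mono_neutral_right)
    show "\<forall>x\<in>T - {(I, J)}. coeff (Q x) J = 0"
    proof
      fix x assume x: "x \<in> T - {(I, J)}"
      obtain a b where ab: "x = (a, b)" by (cases x)
      have "b \<le> J" unfolding J_def using x ab T by (intro Max_ge) (auto intro: rev_image_eqI)
      moreover have "b \<noteq> J" using x ab IJ by (auto simp: T_def)
      ultimately show "coeff (Q x) J = 0" using ab coeff0 by simp
    qed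
  qed (use T IJ in auto)
  also have "\<dots> = c (I, J)" by (simp add: coeff)
  finally show False using IJ by (auto simp: T_def)
qed


section \<open>The canonical generator of the centralizer in \<open>B\<close>\<close>

text \<open>
  Throughout, \<open>f\<close> stands for the coefficient \<open>\<alpha>'\<close> of \<open>u = \<alpha>' X\<^sup>n\<close>. Since \<open>t = sgn n * s\<close>
  has the same sign as \<open>n\<close>, the quotient \<open>n div t\<close> is positive whenever \<open>s > 0\<close> divides \<open>n\<close>.
\<close>

definition is_skew_root :: "'a::field poly fract \<Rightarrow> int \<Rightarrow> int \<Rightarrow> 'a poly fract \<Rightarrow> bool" where
  "is_skew_root f n t \<beta> \<longleftrightarrow> monic_fract \<beta> \<and> (\<Prod>i<nat (n div t). sigma (int i * t) \<beta>) = f"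

definition gen_step :: "'a::field poly fract \<Rightarrow> int \<Rightarrow> nat" where
  "gen_step f n = (LEAST s. 0 < s \<and> int s dvd n \<and> (\<exists>\<beta>. is_skew_root f n (sgn n * int s) \<beta>))"

definition gen_deg :: "'a::field poly fract \<Rightarrow> int \<Rightarrow> int" where
  "gen_deg f n = sgn n * int (gen_step f n)"

definition canonical_generator :: "'a::field poly fract \<Rightarrow> int \<Rightarrow> 'a skew_laurent" where
  "canonical_generator f n =
     sl_monom (THE \<beta>. is_skew_root f n (gen_deg f n) \<beta>) (gen_deg f n)"

definition gen_exponent :: "'a::field poly fract \<Rightarrow> int \<Rightarrow> nat" where
  "gen_exponent f n = nat (n div gen_deg f n)"

definition mu :: "'a::field skew_laurent \<Rightarrow> nat \<Rightarrow> nat \<Rightarrow> nat" where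
  "mu v m i = (LEAST j. v ^ j \<in> weyl \<and> [j = i] (mod m))"

end

theory Submission
  imports Defs
begin

text \<open>
  A rational function fixed by a nonzero power of \<open>\<sigma>\<close> is constant, so the elements \<open>g X\<^sup>k\<close> commuting
  with \<open>u\<close> are unique up to scalars for each \<open>k\<close>, and the degrees \<open>k\<close> that occur form a subgroup of the
  integers. By minimality of \<open>s\<close> this subgroup is generated by \<open>t\<close>, hence each of these elements is
  a scalar multiple of a power of \<open>v\<close>. As the Weyl algebra is graded, a centralizing element is a
  combination of powers \<open>v\<^sup>j\<close> lying in the Weyl algebra; negative \<open>j\<close> cannot occur because a
  nonconstant homogeneous element is not invertible there. Sorting the exponents \<open>j\<close> by their residue
  modulo \<open>m\<close> gives the decomposition. Each residue class occurs because \<open>u\<^sup>l v\<^sup>i\<close> lies in the Weyl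
  algebra for suitable \<open>l\<close>.
\<close>

section \<open>Shifted polynomials\<close>

lemma degree_shift_poly [simp]: "degree (shift_poly k p) = degree p"
  by (simp add: shift_poly_def degree_pcompose)

lemma lead_coeff_shift_poly [simp]: "lead_coeff (shift_poly k p) = lead_coeff p"
  using lead_coeff_comp [of "[:- of_int k, 1:]" p]
  by (simp add: shift_poly_def degree_pcompose)

lemma poly_shift_poly: "poly (shift_poly k p) x = poly p (x - of_int k)"
  by (simp add: shift_poly_def poly_pcompose algebra_simps)

lemma sigma_eq_0_iff [simp]: "sigma k f = 0 \<longleftrightarrow> f = 0"
proof
  assume "sigma k f = 0"
  then have "sigma (- k) (sigma k f) = 0" by simp
  then show "f = 0" by (simp add: sigma_sigma)
qed simp

lemma sigma_inverse: "sigma k (inverse f) = inverse (sigma k f)"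
proof (cases "f = 0")
  case False
  then have "sigma k (inverse f) * sigma k f = 1" by (simp flip: sigma_mult)
  then show ?thesis by (metis inverse_unique mult.commute)
qed simp

lemma sigma_divide: "sigma k (f / g) = sigma k f / sigma k g"
  by (simp add: divide_inverse sigma_mult sigma_inverse)

text \<open>
  If \<open>p/q\<close> is invariant and \<open>q a \<noteq> 0\<close>, then \<open>p - (p a/q a) q\<close> vanishes at the infinitely many points
  \<open>a - k l\<close>.
\<close>

lemma sigma_fixed_imp_const:
  fixes h :: "'a::field_char_0 poly fract"
  assumes fixed: "sigma k h = h" and k: "k \<noteq> 0"
  obtains c where "h = to_fract [:c:]"
proof -
  obtain p q where h: "h = Fract p q" and q: "q \<noteq> 0" by (cases h) auto
  have iter: "sigma (int l * k) h = h" for l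
  proof (induction l)
    case (Suc l)
    have "sigma (int (Suc l) * k) h = sigma k (sigma (int l * k) h)"
      by (simp add: sigma_sigma algebra_simps)
    then show ?case using Suc fixed by simp
  qed simp
  obtain a where a: "poly q a \<noteq> 0" using q poly_all_0_iff_0 by blast
  define c where "c = poly p a / poly q a"
  have root: "poly (p - smult c q) (a - of_int (int l * k)) = 0" for l
  proof -
    have "shift_poly (int l * k) p * q = p * shift_poly (int l * k) q"
      using iter [of l] q by (simp add: h sigma_Fract eq_fract)
    then have "poly (shift_poly (int l * k) p * q) a = poly (p * shift_poly (int l * k) q) a"
      by simp
    then show ?thesis using a by (simp add: poly_shift_poly c_def field_simps)
  qed
  have "p - smult c q = 0"
  proof (rule ccontr)
    assume "p - smult c q \<noteq> 0"
    then have "finite {x. poly (p - smult c q) x = 0}" by (rule poly_roots_finite)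
    moreover have "range (\<lambda>l. a - of_int (int l * k)) \<subseteq> {x. poly (p - smult c q) x = 0}"
      using root by blast
    ultimately have "finite (range (\<lambda>l. a - of_int (int l * k)))" by (rule finite_subset [rotated])
    moreover have "inj (\<lambda>l. a - of_int (int l * k))"
      using k by (auto simp: inj_on_def)
    ultimately show False using finite_imageD infinite_UNIV_nat by blast
  qed
  then have "h = to_fract [:c:]"
    using q by (simp add: h to_fract_def eq_fract)
  then show thesis using that by blast
qed

lemma shift_poly_fixed_imp_const:
  fixes p :: "'a::field_char_0 poly"
  assumes "shift_poly k p = p" "k \<noteq> 0"
  obtains c where "p = [:c:]"
  using sigma_fixed_imp_const [of k "to_fract p"] assms by (auto simp: sigma_to_fract)

text \<open>Over a field a nonconstant polynomial is either irreducible, hence prime, or a product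
  of two factors of smaller degree, so induction on the degree applies.\<close>

lemma poly_prime_mult_induct [consumes 1, case_names const prime mult]:
  fixes q :: "'a::field poly"
  assumes "q \<noteq> 0"
    and const: "\<And>c. c \<noteq> 0 \<Longrightarrow> P [:c:]"
    and prime: "\<And>p. prime_elem p \<Longrightarrow> P p"
    and mult: "\<And>a b. a \<noteq> 0 \<Longrightarrow> b \<noteq> 0 \<Longrightarrow> P a \<Longrightarrow> P b \<Longrightarrow> P (a * b)"
  shows "P q"
  using \<open>q \<noteq> 0\<close>
proof (induction "degree q" arbitrary: q rule: less_induct)
  case less
  show ?case
  proof (cases "degree q = 0 \<or> irreducible q")
    case True
    then show ?thesis
      using less.prems by (auto intro: const prime field_poly_irreducible_imp_prime elim!: degree_eq_zeroE)
  next
    case False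
    then have "\<not> q dvd 1" "\<not> irreducible q" using less.prems by (auto simp: is_unit_iff_degree)
    then obtain a b where ab: "q = a * b" "\<not> a dvd 1" "\<not> b dvd 1"
      using less.prems unfolding irreducible_def by blast
    have nz: "a \<noteq> 0" "b \<noteq> 0" using ab less.prems by auto
    then have "degree a > 0" "degree b > 0" using ab by (auto simp: is_unit_iff_degree)
    then show ?thesis using less.hyps [of a] less.hyps [of b] ab nz
      by (auto simp: degree_mult_eq intro!: mult)
  qed
qed

text \<open>Shifting is an automorphism, so a shifted prime is irreducible and a nonconstant divisor
  is an associate. The scalar is read off leading coefficients, hence does not depend on
  \<open>l\<close>.\<close>

lemma divisor_of_shifted_prime:
  fixes q :: "'a::field poly"
  assumes q: "prime_elem q" and a: "a dvd shift_poly l q" "degree a > 0"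
  shows "shift_poly l q = smult (lead_coeff q / lead_coeff a) a"
proof -
  obtain r where r: "shift_poly l q = a * r" using a by blast
  have q0: "q \<noteq> 0" using q by auto
  then have nz: "a \<noteq> 0" "r \<noteq> 0" using r by auto
  have "q = shift_poly (- l) a * shift_poly (- l) r"
    by (simp add: shift_poly_shift_poly flip: r shift_poly_mult)
  then have "shift_poly (- l) a dvd 1 \<or> shift_poly (- l) r dvd 1"
    using prime_elem_imp_irreducible [OF q] by (rule irreducibleD [rotated])
  then have "degree r = 0" using a nz by (auto simp: is_unit_iff_degree)
  then obtain c where c: "r = [:c:]" by (auto elim: degree_eq_zeroE)
  have "lead_coeff q = lead_coeff a * c"
    using arg_cong [OF r, of lead_coeff] unfolding c lead_coeff_shift_poly by (simp add: lead_coeff_mult)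
  then show ?thesis using r nz by (simp add: c)
qed

text \<open>If \<open>p\<close> divides two shifts of a prime \<open>q\<close>, both are the same
  multiple of \<open>p\<close>; for different shifts \<open>q\<close> would be fixed by a nonzero
  shift, hence constant. So a prime admits at most one \<open>l\<close>, and for products the sets
  are united.\<close>

lemma finite_prime_dvd_shift:
  fixes p q :: "'a::field_char_0 poly"
  assumes p: "prime_elem p" and q: "q \<noteq> 0"
  shows "finite {l. p dvd shift_poly l q}"
proof -
  have p0: "degree p > 0" using p is_unit_iff_degree [of p] by (auto simp: prime_elem_def)
  show ?thesis
    using q
  proof (induction q rule: poly_prime_mult_induct)
    case (const c)
    have "\<not> p dvd shift_poly l [:c:]" for l
    proof
      assume "p dvd shift_poly l [:c:]"
      then have "p dvd [:c:]" by (simp add: shift_poly_def)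
      from dvd_imp_degree_le [OF this] const p0 show False by simp
    qed
    then show ?case by simp
  next
    case (prime q)
    have "l = l'" if l: "p dvd shift_poly l q" "p dvd shift_poly l' q" for l l'
    proof (rule ccontr)
      assume "l \<noteq> l'"
      have "shift_poly l q = shift_poly l' q"
        using divisor_of_shifted_prime [OF prime] l p0 by metis
      then have "shift_poly (- l') (shift_poly l q) = q" by (simp add: shift_poly_shift_poly)
      then obtain c where "q = [:c:]"
        using \<open>l \<noteq> l'\<close> shift_poly_fixed_imp_const [of "l - l'" q] by (auto simp: shift_poly_shift_poly)
      then show False using prime is_unit_iff_degree [of q] by (auto simp: prime_elem_def)
    qed
    then show ?case by (cases "\<exists>l. p dvd shift_poly l q") (auto intro: finite_subset [of _ "{_}"])
  next
    case (mult a b)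
    have "{l. p dvd shift_poly l (a * b)} \<subseteq> {l. p dvd shift_poly l a} \<union> {l. p dvd shift_poly l b}"
      using p by (auto simp: shift_poly_mult prime_elem_dvd_mult_iff)
    then show ?case using mult.IH finite_subset by blast
  qed
qed

text \<open>Coprimality is phrased as cancellation, the form needed to clear a denominator. Factors
  of \<open>p\<close> are cancelled one after another, which reduces the claim to prime
  \<open>p\<close>, where a bad \<open>l\<close> satisfies
  \<open>p dvd shift_poly l q\<close>.\<close>

lemma finite_not_coprime_shift:
  fixes p q :: "'a::field_char_0 poly"
  assumes p: "p \<noteq> 0" and q: "q \<noteq> 0"
  shows "finite {l. \<exists>a. p dvd a * shift_poly l q \<and> \<not> p dvd a}"
  using p
proof (induction p rule: poly_prime_mult_induct)
  case (const c)
  then have "[:c:] dvd a" for a :: "'a poly"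
    by (meson dvd_trans is_unit_const_poly_iff dvd_field_iff one_dvd)
  then show ?case by simp
next
  case (prime p)
  then have "{l. \<exists>a. p dvd a * shift_poly l q \<and> \<not> p dvd a} \<subseteq> {l. p dvd shift_poly l q}"
    by (auto simp: prime_elem_dvd_mult_iff)
  then show ?case using finite_prime_dvd_shift [OF prime q] finite_subset by blast
next
  case (mult a b)
  let ?S = "\<lambda>p. {l. \<exists>a. p dvd a * shift_poly l q \<and> \<not> p dvd a}"
  have "l \<in> ?S a \<union> ?S b" if "l \<in> ?S (a * b)" for l
  proof (rule ccontr)
    assume l: "l \<notin> ?S a \<union> ?S b"
    obtain x where x: "a * b dvd x * shift_poly l q" "\<not> a * b dvd x" using \<open>l \<in> ?S (a * b)\<close> by blast
    from x(1) have "a dvd x * shift_poly l q" by (rule dvd_mult_left)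
    then have "a dvd x" using l by blast
    then obtain y where y: "x = a * y" ..
    then have "b dvd y * shift_poly l q" using x(1) mult.hyps by (simp add: mult.assoc)
    then have "b dvd y" using l by blast
    then show False using x(2) by (simp add: y)
  qed
  then show ?case using mult.IH by (meson finite_Un finite_subset subsetI)
qed

section \<open>Homogeneous components\<close>

lemma sl_coeff_0 [simp]: "sl_coeff 0 k = 0"
  by (simp add: zero_skew_laurent.rep_eq)

lemma sl_coeff_add [simp]: "sl_coeff (w + z) k = sl_coeff w k + sl_coeff z k"
  by (simp add: plus_skew_laurent.rep_eq)

lemma sl_coeff_sum: "sl_coeff (\<Sum>i\<in>I. w i) k = (\<Sum>i\<in>I. sl_coeff (w i) k)"
  by (induction I rule: infinite_finite_induct) auto

lemma sl_monom_eq_iff: "sl_monom f k = sl_monom g k \<longleftrightarrow> f = g"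
  by (metis sl_coeff_monom)

lemma sl_coeff_monom_times: "sl_coeff (sl_monom g i * w) k = g * sigma i (sl_coeff w (k - i))"
  by (subst sl_coeff_times [of "{i}"]) (auto simp: sl_coeff_monom)

lemma sl_coeff_times_monom: "sl_coeff (w * sl_monom g i) k = sl_coeff w (k - i) * sigma (k - i) g"
proof -
  let ?S = "insert (k - i) {j. sl_coeff w j \<noteq> 0}"
  have "sl_coeff (w * sl_monom g i) k
      = (\<Sum>j\<in>?S. sl_coeff w j * sigma j (if k - j = i then g else 0))"
    by (subst sl_coeff_times [of ?S]) (auto simp: sl_coeff_monom)
  also have "\<dots> = (\<Sum>j\<in>?S. if j = k - i then sl_coeff w j * sigma j g else 0)"
    by (rule sum.cong) auto
  also have "\<dots> = sl_coeff w (k - i) * sigma (k - i) g"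
    by (subst sum.delta) auto
  finally show ?thesis .
qed

lemma sl_monom_decomposition: "w = (\<Sum>k | sl_coeff w k \<noteq> 0. sl_monom (sl_coeff w k) k)"
  by (rule sl_eqI) (auto simp: sl_coeff_sum sl_coeff_monom)

text \<open>The twisted product is the one in \<open>is_skew_root\<close>, so skew roots become
  genuine roots in \<open>B\<close>.\<close>

lemma sl_monom_power:
  "sl_monom g k ^ j = sl_monom (\<Prod>i<j. sigma (int i * k) g) (int j * k)"
proof (induction j)
  case (Suc j)
  have "sl_monom g k ^ Suc j = sl_monom g k ^ j * sl_monom g k" by (rule power_Suc2)
  then show ?case unfolding Suc by (simp add: sl_monom_mult algebra_simps)
qed (simp add: sl_monom_1_0)

lemma sl_monom_inverse:
  assumes "g \<noteq> 0"
  obtains h where "h \<noteq> 0" "sl_monom g k * sl_monom h (- k) = 1" "sl_monom h (- k) * sl_monom g k = 1"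
proof
  \<comment> \<open>The witness comes from \<open>X^(-k) g^(-1)\<close> by moving the coefficient to
    the left.\<close>
  show "sigma (- k) (inverse g) \<noteq> 0" using assms by simp
qed (use assms in \<open>simp_all add: sl_monom_mult sigma_sigma sl_monom_1_0 flip: sigma_mult\<close>)

lemma commutes_monom_iff:
  "sl_monom g k * sl_monom f n = sl_monom f n * sl_monom g k \<longleftrightarrow> g * sigma k f = f * sigma n g"
  by (simp add: sl_monom_mult add.commute [of n k] sl_monom_eq_iff)

text \<open>Only the degree \<open>k\<close> part of \<open>w\<close> contributes to degree
  \<open>k + n\<close> of either product, so the relation splits into homogeneous parts.\<close>

lemma commutes_monom_component:
  assumes "w * sl_monom f n = sl_monom f n * w"
  shows "sl_monom (sl_coeff w k) k * sl_monom f n = sl_monom f n * sl_monom (sl_coeff w k) k"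
proof -
  have "sl_coeff (w * sl_monom f n) (k + n) = sl_coeff (sl_monom f n * w) (k + n)"
    by (simp add: assms)
  then show ?thesis
    by (simp add: commutes_monom_iff sl_coeff_monom_times sl_coeff_times_monom)
qed

lemma commutes_mult:
  fixes x y u :: "'b::semigroup_mult"
  assumes "x * u = u * x" "y * u = u * y"
  shows "(x * y) * u = u * (x * y)"
  by (metis assms mult.assoc)

text \<open>Dividing the two commutation relations cancels \<open>f\<close> and
  \<open>sigma k f\<close>; thus \<open>g / h\<close> is fixed by \<open>sigma n\<close> and is
  constant.\<close>

lemma commuting_same_degree_proportional:
  fixes f :: "'a::field_char_0 poly fract"
  assumes "f \<noteq> 0" "n \<noteq> 0" "h \<noteq> 0"
    and g: "sl_monom g k * sl_monom f n = sl_monom f n * sl_monom g k"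
    and h: "sl_monom h k * sl_monom f n = sl_monom f n * sl_monom h k"
  obtains c where "g = to_fract [:c:] * h"
proof -
  have "sigma n (g / h) = (f * sigma n g) / (f * sigma n h)"
    using \<open>f \<noteq> 0\<close> by (simp add: sigma_divide)
  also have "\<dots> = (g * sigma k f) / (h * sigma k f)"
    using g h by (simp add: commutes_monom_iff)
  also have "\<dots> = g / h" using \<open>f \<noteq> 0\<close> by simp
  finally obtain c where "g / h = to_fract [:c:]"
    using \<open>n \<noteq> 0\<close> sigma_fixed_imp_const by blast
  then show thesis using that \<open>h \<noteq> 0\<close> by (simp add: field_simps)
qed


section \<open>The grading of the Weyl algebra\<close>

text \<open>The rising factorial \<open>H (H + 1) ... (H + j - 1)\<close>.\<close>

fun wY_coeff :: "nat \<Rightarrow> 'a::field poly" where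
  "wY_coeff 0 = 1"
| "wY_coeff (Suc j) = [:0, 1:] * shift_poly (- 1) (wY_coeff j)"

text \<open>The factor that translates between the bases \<open>wv k\<close> and \<open>X^k\<close>:
  the degree \<open>k\<close> part of the Weyl algebra is
  \<open>K[H] * wv_coeff k * X^k\<close>.\<close>

definition wv_coeff :: "int \<Rightarrow> 'a::field poly" where
  "wv_coeff k = (if k \<ge> 0 then 1 else wY_coeff (nat (- k)))"

lemma wY_power_eq: "(wY :: 'a::field skew_laurent) ^ j = sl_monom (to_fract (wY_coeff j)) (- int j)"
proof (induction j)
  case (Suc j)
  have "(wY :: 'a skew_laurent) ^ Suc j = wY * sl_monom (to_fract (wY_coeff j)) (- int j)" by (simp add: Suc)
  then show ?case
    unfolding wY_def sl_monom_mult sigma_to_fract wY_coeff.simps to_fract_mult by simp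
qed (simp add: sl_monom_1_0)

lemma wv_eq: "wv k = sl_monom (to_fract (wv_coeff k)) k"
  by (auto simp: wv_def wv_coeff_def wX_power wY_power_eq sl_monom_1_0)

text \<open>Without opposite signs, both factors are powers of a single generator.\<close>

lemma wv_add: "0 \<le> k * l \<Longrightarrow> wv (k + l) = wv k * wv l"
  by (auto simp: wv_def zero_le_mult_iff nat_add_distrib simp flip: power_add)
    (auto simp flip: power_add simp: nat_add_distrib [symmetric] add.commute)

lemma wv_coeff_add:
  assumes "0 \<le> k * l"
  shows "wv_coeff (k + l) = wv_coeff k * shift_poly k (wv_coeff l)"
  using wv_add [OF assms]
  by (simp add: wv_eq sl_monom_mult sigma_to_fract sl_monom_eq_iff flip: to_fract_mult)

lemma wY_coeff_monic:
  "degree (wY_coeff j :: 'a::field poly) = j \<and> lead_coeff (wY_coeff j :: 'a poly) = 1"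
proof (induction j)
  case (Suc j)
  then have nz: "(wY_coeff j :: 'a poly) \<noteq> 0" by (metis coeff_0 zero_neq_one)
  have "degree ([:0, 1:] * shift_poly (- 1) (wY_coeff j :: 'a poly)) = Suc j"
    by (subst degree_mult_eq) (use Suc nz in auto)
  moreover have "lead_coeff ([:0, 1:] * shift_poly (- 1) (wY_coeff j :: 'a poly)) = 1"
    by (simp only: lead_coeff_mult lead_coeff_shift_poly) (use Suc in auto)
  ultimately show ?case by simp
qed simp

lemma degree_wv_coeff: "degree (wv_coeff k) = nat (- k)"
  using wY_coeff_monic [of "nat (- k)"] by (auto simp: wv_coeff_def)

lemma lead_coeff_wv_coeff [simp]: "lead_coeff (wv_coeff k) = 1"
  using wY_coeff_monic [of "nat (- k)"] by (auto simp: wv_coeff_def)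

lemma wv_coeff_nonzero [simp]: "wv_coeff k \<noteq> 0"
  using lead_coeff_wv_coeff [of k] by (metis coeff_0 zero_neq_one)

section \<open>Generated subalgebras and the homogeneous parts of the Weyl algebra\<close>

lemma subalg_sum: "(\<And>i. i \<in> I \<Longrightarrow> w i \<in> subalg S) \<Longrightarrow> (\<Sum>i\<in>I. w i) \<in> subalg S"
proof (induction I rule: infinite_finite_induct)
  case empty
  show ?case using subalg.const [of 0 S] by (simp add: sl_const_def)
next
  case (infinite I)
  then show ?case using subalg.const [of 0 S] by (simp add: sl_const_def)
qed (auto intro: subalg.add)

lemma sl_const_1: "sl_const 1 = 1"
  by (simp add: sl_const_def sl_monom_1_0 flip: one_pCons)

lemma subalg_1: "1 \<in> subalg S"
  using subalg.const [of 1 S] by (simp add: sl_const_1)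

lemma subalg_power: "w \<in> subalg S \<Longrightarrow> w ^ j \<in> subalg S"
  by (induction j) (auto intro: subalg_1 subalg.mult)

lemma subalg_subset:
  assumes "S \<subseteq> subalg T"
  shows "subalg S \<subseteq> subalg T"
proof
  fix w assume "w \<in> subalg S"
  then show "w \<in> subalg T" by induction (use assms in \<open>auto intro: subalg.intros\<close>)
qed

lemma hpoly_in_weyl: "hpoly p \<in> weyl"
proof -
  have "subalg {wH} \<subseteq> weyl"
    unfolding weyl_def wH_def by (rule subalg_subset) (auto intro: subalg.intros)
  then show ?thesis by (auto simp: subalg_wH)
qed

lemma wv_in_weyl: "wv k \<in> weyl"
  by (auto simp: wv_def weyl_def intro: subalg_power subalg_1 subalg.gen)

text \<open>Each component is then \<open>hpoly p * wv k\<close>, a product of elements of the Weyl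
  algebra.\<close>

lemma graded_imp_in_weyl:
  assumes "\<And>k. \<exists>p. sl_coeff w k = to_fract (p * wv_coeff k)"
  shows "w \<in> weyl"
proof -
  have "sl_monom (sl_coeff w k) k \<in> weyl" for k
  proof -
    obtain p where "sl_coeff w k = to_fract (p * wv_coeff k)" using assms by blast
    then have "sl_monom (sl_coeff w k) k = hpoly p * wv k"
      by (simp add: hpoly_def wv_eq sl_monom_mult)
    then show ?thesis
      using hpoly_in_weyl wv_in_weyl unfolding weyl_def by (auto intro: subalg.mult)
  qed
  then have "(\<Sum>k | sl_coeff w k \<noteq> 0. sl_monom (sl_coeff w k) k) \<in> weyl"
    unfolding weyl_def by (auto intro: subalg_sum)
  then show ?thesis by (simp flip: sl_monom_decomposition)
qed

text \<open>Closure under left multiplication by the generators is enough, since \<open>w = w \<cdot> 1\<close>.\<close>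

lemma in_weyl_imp_graded:
  fixes w :: "'a::field skew_laurent"
  assumes "w \<in> weyl"
  shows "\<exists>p. sl_coeff w k = to_fract (p * wv_coeff k)"
proof -
  define W :: "'a skew_laurent set"
    where "W = {w. \<forall>k. \<exists>p. sl_coeff w k = to_fract (p * wv_coeff k)}"
  have X: "wX * z \<in> W" if z: "z \<in> W" for z
  proof -
    have "\<exists>p. sl_coeff (wX * z) k = to_fract (p * wv_coeff k)" for k
    proof -
      obtain p where p: "sl_coeff z (k - 1) = to_fract (p * wv_coeff (k - 1))"
        using z by (auto simp: W_def)
      \<comment> \<open>For \<open>k \<le> 0\<close> the shift by \<open>1\<close> undoes the one in
        the recursion of \<open>wY_coeff\<close> and leaves a spare factor \<open>H - 1\<close>; for
        \<open>k > 0\<close> the divisor is \<open>1\<close>.\<close>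
      have "wv_coeff k dvd shift_poly 1 (wv_coeff (k - 1) :: 'a poly)"
      proof (cases "k > 0")
        case False
        then have "nat (- (k - 1)) = Suc (nat (- k))" by simp
        then have "wv_coeff (k - 1) = [:0, 1:] * shift_poly (- 1) (wv_coeff k :: 'a poly)"
          using False by (auto simp: wv_coeff_def)
        then show ?thesis by (simp only: shift_poly_mult shift_poly_shift_poly) simp
      qed (simp add: wv_coeff_def)
      then obtain r where "shift_poly 1 (wv_coeff (k - 1) :: 'a poly) = wv_coeff k * r" ..
      then have "sl_coeff (wX * z) k = to_fract (shift_poly 1 p * r * wv_coeff k)"
        by (simp add: wX_def sl_coeff_monom_times p sigma_mult sigma_to_fract algebra_simps)
      then show ?thesis ..
    qed
    then show ?thesis by (simp add: W_def)
  qed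
  have Y: "wY * z \<in> W" if z: "z \<in> W" for z
  proof -
    have "\<exists>p. sl_coeff (wY * z) k = to_fract (p * wv_coeff k)" for k
    proof -
      obtain p where p: "sl_coeff z (k + 1) = to_fract (p * wv_coeff (k + 1))"
        using z by (auto simp: W_def)
      \<comment> \<open>For \<open>k < 0\<close> this is the recursion of \<open>wY_coeff\<close>
        itself; otherwise the divisor is \<open>1\<close>.\<close>
      have "wv_coeff k dvd [:0, 1:] * shift_poly (- 1) (wv_coeff (k + 1) :: 'a poly)"
      proof (cases "k \<ge> 0")
        case False
        then have "nat (- k) = Suc (nat (- (k + 1)))" by simp
        then have "wv_coeff k = [:0, 1:] * shift_poly (- 1) (wv_coeff (k + 1) :: 'a poly)"
          using False by (auto simp: wv_coeff_def)
        then show ?thesis by simp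
      qed (simp add: wv_coeff_def)
      then obtain r where
        r: "[:0, 1:] * shift_poly (- 1) (wv_coeff (k + 1) :: 'a poly) = wv_coeff k * r" ..
      have "sl_coeff (wY * z) k
          = to_fract (shift_poly (- 1) p * ([:0, 1:] * shift_poly (- 1) (wv_coeff (k + 1))))"
        unfolding to_fract_mult
        by (simp add: wY_def sl_coeff_monom_times p sigma_mult sigma_to_fract mult.left_commute)
      also have "\<dots> = to_fract (shift_poly (- 1) p * r * wv_coeff k)"
        unfolding r by (simp add: mult_ac)
      finally show ?thesis ..
    qed
    then show ?thesis by (simp add: W_def)
  qed
  have "\<forall>z\<in>W. w * z \<in> W"
    using assms unfolding weyl_def
  proof induction
    case (gen x)
    then show ?case using X Y by auto
  next
    case (const c)
    show ?case
    proof
      fix z assume z: "z \<in> W"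
      have "\<exists>p. sl_coeff (sl_const c * z) k = to_fract (p * wv_coeff k)" for k
      proof -
        obtain p where "sl_coeff z k = to_fract (p * wv_coeff k)" using z by (auto simp: W_def)
        then have "sl_coeff (sl_const c * z) k = to_fract ([:c:] * p * wv_coeff k)"
          unfolding to_fract_mult by (simp add: sl_const_def sl_coeff_monom_times)
        then show ?thesis ..
      qed
      then show "sl_const c * z \<in> W" by (simp add: W_def)
    qed
  next
    case (add x y)
    show ?case
    proof
      fix z assume z: "z \<in> W"
      have "\<exists>p. sl_coeff ((x + y) * z) k = to_fract (p * wv_coeff k)" for k
      proof -
        obtain p q where "sl_coeff (x * z) k = to_fract (p * wv_coeff k)"
          "sl_coeff (y * z) k = to_fract (q * wv_coeff k)"
          using add.IH z by (auto simp: W_def) metis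
        then have "sl_coeff ((x + y) * z) k = to_fract ((p + q) * wv_coeff k)"
          by (simp add: distrib_right)
        then show ?thesis ..
      qed
      then show "(x + y) * z \<in> W" by (simp add: W_def)
    qed
  next
    case (mult x y)
    then show ?case by (simp add: mult.assoc)
  qed
  moreover have "1 \<in> W"
    by (auto simp: W_def one_skew_laurent.rep_eq wv_coeff_def intro: exI [of _ 1] exI [of _ 0])
  ultimately have "w * 1 \<in> W" by blast
  then show ?thesis by (simp add: W_def)
qed

lemma weyl_component: "w \<in> weyl \<Longrightarrow> sl_monom (sl_coeff w k) k \<in> weyl"
  using in_weyl_imp_graded [of w k]
  by (intro graded_imp_in_weyl) (auto simp: sl_coeff_monom intro: exI [of _ 0])

lemma sl_monom_in_weyl_iff: "sl_monom g k \<in> weyl \<longleftrightarrow> (\<exists>p. g = to_fract (p * wv_coeff k))"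
proof
  assume "sl_monom g k \<in> weyl"
  from in_weyl_imp_graded [OF this, of k] show "\<exists>p. g = to_fract (p * wv_coeff k)"
    by (simp add: sl_coeff_monom)
next
  assume "\<exists>p. g = to_fract (p * wv_coeff k)"
  then show "sl_monom g k \<in> weyl"
    by (intro graded_imp_in_weyl) (auto simp: sl_coeff_monom intro: exI [of _ 0])
qed


section \<open>Homogeneous elements commuting with a homogeneous element\<close>

lemma monic_fract_nonzero: "monic_fract f \<Longrightarrow> f \<noteq> 0"
proof -
  assume "monic_fract f"
  then obtain p q where pq: "lead_coeff p = 1" "lead_coeff q = 1" "f = Fract p q"
    by (auto simp: monic_fract_def)
  then have "p \<noteq> 0" "q \<noteq> 0" by auto
  then show "f \<noteq> 0" using pq by (simp add: eq_fract Zero_fract_def)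
qed

lemma monic_fract_mult: "monic_fract f \<Longrightarrow> monic_fract g \<Longrightarrow> monic_fract (f * g)"
proof -
  assume "monic_fract f" "monic_fract g"
  then obtain p q p' q' where "lead_coeff p = 1" "lead_coeff q = 1" "f = Fract p q"
    "lead_coeff p' = 1" "lead_coeff q' = 1" "g = Fract p' q'"
    by (auto simp: monic_fract_def)
  then show ?thesis unfolding monic_fract_def
    by (intro exI [of _ "p * p'"] exI [of _ "q * q'"]) (simp add: lead_coeff_mult)
qed

lemma monic_fract_sigma: "monic_fract f \<Longrightarrow> monic_fract (sigma k f)"
  unfolding monic_fract_def by (metis sigma_Fract lead_coeff_shift_poly)

lemma monic_fract_to_fract: "lead_coeff p = 1 \<Longrightarrow> monic_fract (to_fract p)"
  unfolding monic_fract_def to_fract_def by (intro exI [of _ p] exI [of _ 1]) simp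

lemma monic_fract_prod: "(\<And>i. i \<in> I \<Longrightarrow> monic_fract (g i)) \<Longrightarrow> monic_fract (\<Prod>i\<in>I. g i)"
  using monic_fract_to_fract [of 1]
  by (induction I rule: infinite_finite_induct) (auto intro: monic_fract_mult)

text \<open>Leading coefficients after cross-multiplication force \<open>c = 1\<close>. This turns
  proportionality of monic elements into equality.\<close>

lemma monic_fract_const_mult_eq:
  assumes "monic_fract f" "monic_fract (to_fract [:c:] * f)"
  shows "to_fract [:c:] * f = f"
proof -
  obtain p q where pq: "lead_coeff p = 1" "lead_coeff q = 1" "f = Fract p q"
    using assms(1) by (auto simp: monic_fract_def)
  obtain p' q' where pq': "lead_coeff p' = 1" "lead_coeff q' = 1" "to_fract [:c:] * f = Fract p' q'"
    using assms(2) by (auto simp: monic_fract_def)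
  have "q \<noteq> 0" "q' \<noteq> 0" using pq pq' by auto
  then have "smult c p * q' = p' * q"
    using pq pq' by (auto simp: to_fract_def eq_fract)
  then have "lead_coeff (smult c p * q') = lead_coeff (p' * q)" by simp
  then have "c = 1" using pq pq' by (simp only: lead_coeff_mult lead_coeff_smult) simp
  then show ?thesis by (simp flip: one_pCons)
qed

lemma monic_fract_normalize:
  assumes "g \<noteq> 0"
  obtains c where "monic_fract (to_fract [:c:] * g)"
proof -
  obtain p q where g: "g = Fract p q" and q: "q \<noteq> 0" by (cases g) auto
  then have p: "p \<noteq> 0" using assms by (auto simp: eq_fract Zero_fract_def)
  let ?c = "lead_coeff q / lead_coeff p"
  have "to_fract [:?c:] * g = Fract (smult (inverse (lead_coeff p)) p) (smult (inverse (lead_coeff q)) q)"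
    using p q by (simp add: g to_fract_def eq_fract field_simps)
  then have "monic_fract (to_fract [:?c:] * g)"
    unfolding monic_fract_def using p q
    by (intro exI [of _ "smult (inverse (lead_coeff p)) p"] exI [of _ "smult (inverse (lead_coeff q)) q"])
      simp
  then show thesis by (rule that)
qed

text \<open>Positivity of the quotient ensures that \<open>nat\<close> truncates nothing in
  \<open>is_skew_root\<close> and \<open>gen_exponent\<close>.\<close>

lemma signed_divisor:
  fixes n :: int
  assumes "n \<noteq> 0" "int d dvd n" "0 < d"
  shows "sgn n * int d * (n div (sgn n * int d)) = n" "0 < n div (sgn n * int d)"
proof -
  have "sgn n * int d dvd n" using assms by (auto simp: sgn_if)
  then show *: "sgn n * int d * (n div (sgn n * int d)) = n" by simp
  then have "0 < \<bar>n\<bar> * (n div (sgn n * int d))"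
    using assms(1,3)
    by (smt (verit) mult_pos_pos mult_less_0_iff sgn_if zero_less_mult_iff of_nat_0_less_iff mult_minus_left)
  then show "0 < n div (sgn n * int d)" by (simp add: zero_less_mult_iff)
qed

lemma sl_const_times_monom: "sl_const c * sl_monom g k = sl_monom (to_fract [:c:] * g) k"
  by (simp add: sl_const_def sl_monom_mult)

lemma sl_const_mult: "sl_const c * sl_const d = sl_const (c * d)"
  by (simp add: sl_const_def sl_monom_mult mult.commute flip: to_fract_mult)

text \<open>The canonical generator is a matter of \<open>B\<close> alone; membership of
  \<open>u\<close> in the Weyl algebra enters later as a separate assumption.\<close>

locale monic_homogeneous =
  fixes f :: "'a::field_char_0 poly fract" and n :: int
  assumes n: "n \<noteq> 0" and monic: "monic_fract f"
begin

abbreviation "u \<equiv> sl_monom f n"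
abbreviation "t \<equiv> gen_deg f n"
abbreviation "m \<equiv> gen_exponent f n"
abbreviation "v \<equiv> canonical_generator f n"

lemma f_nonzero: "f \<noteq> 0"
  using monic by (rule monic_fract_nonzero)

lemma proportional:
  assumes "sl_monom g k * u = u * sl_monom g k" "sl_monom h k * u = u * sl_monom h k" "h \<noteq> 0"
  obtains c where "g = to_fract [:c:] * h"
  using commuting_same_degree_proportional [OF f_nonzero n] assms by blast

section \<open>The subgroup of degrees of homogeneous elements commuting with
  \<open>u\<close>\<close>

definition commuting_degrees :: "int set" where
  "commuting_degrees = {k. \<exists>g. g \<noteq> 0 \<and> sl_monom g k * u = u * sl_monom g k}"

lemma commuting_degreesI: "g \<noteq> 0 \<Longrightarrow> sl_monom g k * u = u * sl_monom g k \<Longrightarrow> k \<in> commuting_degrees"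
  by (auto simp: commuting_degrees_def)

lemma commuting_degrees_0: "0 \<in> commuting_degrees"
  by (rule commuting_degreesI [of 1]) (simp_all add: sl_monom_1_0)

lemma commuting_degrees_add:
  assumes "k \<in> commuting_degrees" "l \<in> commuting_degrees"
  shows "k + l \<in> commuting_degrees"
proof -
  obtain g h where gh: "g \<noteq> 0" "sl_monom g k * u = u * sl_monom g k"
    "h \<noteq> 0" "sl_monom h l * u = u * sl_monom h l"
    using assms by (auto simp: commuting_degrees_def)
  have "(sl_monom g k * sl_monom h l) * u = u * (sl_monom g k * sl_monom h l)"
    using gh by (intro commutes_mult)
  then show ?thesis
    using gh by (intro commuting_degreesI [of "g * sigma k h"]) (simp_all add: sl_monom_mult [of g])
qed

text \<open>Nonzero homogeneous elements are units of \<open>B\<close>, and the inverse of a unit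
  commuting with \<open>u\<close> commutes with \<open>u\<close>.\<close>

lemma commuting_degrees_uminus:
  assumes "k \<in> commuting_degrees"
  shows "- k \<in> commuting_degrees"
proof -
  obtain g where g: "g \<noteq> 0" "sl_monom g k * u = u * sl_monom g k"
    using assms by (auto simp: commuting_degrees_def)
  obtain h where h: "h \<noteq> 0" "sl_monom g k * sl_monom h (- k) = 1" "sl_monom h (- k) * sl_monom g k = 1"
    using sl_monom_inverse [OF g(1)] by blast
  have "sl_monom h (- k) * u = sl_monom h (- k) * u * (sl_monom g k * sl_monom h (- k))"
    by (simp add: h)
  also have "\<dots> = sl_monom h (- k) * (u * sl_monom g k) * sl_monom h (- k)"
    by (simp only: mult.assoc)
  also have "\<dots> = (sl_monom h (- k) * sl_monom g k) * u * sl_monom h (- k)"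
    by (simp only: mult.assoc flip: g(2))
  also have "\<dots> = u * sl_monom h (- k)" by (simp add: h)
  finally show ?thesis using h by (intro commuting_degreesI)
qed

lemma commuting_degrees_mult:
  assumes "k \<in> commuting_degrees"
  shows "l * k \<in> commuting_degrees"
proof -
  have nat: "int j * k \<in> commuting_degrees" for j
    by (induction j) (auto simp: commuting_degrees_0 distrib_right intro: commuting_degrees_add assms)
  show ?thesis
  proof (cases "l \<ge> 0")
    case True
    then show ?thesis using nat [of "nat l"] by simp
  next
    case False
    then show ?thesis using commuting_degrees_uminus [OF nat [of "nat (- l)"]] by simp
  qed
qed

lemma commuting_degrees_gcd:
  assumes "k \<in> commuting_degrees" "l \<in> commuting_degrees"
  shows "gcd k l \<in> commuting_degrees"
proof -
  obtain a b where "a * k + b * l = gcd k l" using bezout_int by blast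
  then show ?thesis
    using commuting_degrees_add [OF commuting_degrees_mult commuting_degrees_mult] assms by metis
qed

text \<open>Seen as a power in \<open>B\<close>, a skew root visibly commutes with
  \<open>u\<close>.\<close>

lemma is_skew_root_iff:
  assumes "0 < d" "int d dvd n"
  shows "is_skew_root f n (sgn n * int d) \<beta> \<longleftrightarrow> monic_fract \<beta> \<and>
    sl_monom \<beta> (sgn n * int d) ^ nat (n div (sgn n * int d)) = u"
proof -
  have "int (nat (n div (sgn n * int d))) * (sgn n * int d) = n"
    using signed_divisor [OF n assms(2,1)] by (simp add: mult.commute)
  then show ?thesis by (simp add: is_skew_root_def sl_monom_power sl_monom_eq_iff)
qed

lemma skew_root_commutes:
  assumes "0 < d" "int d dvd n" "is_skew_root f n (sgn n * int d) \<beta>"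
  shows "sl_monom \<beta> (sgn n * int d) * u = u * sl_monom \<beta> (sgn n * int d)"
  using assms is_skew_root_iff [OF assms(1,2)] power_commutes by metis

text \<open>The \<open>LEAST\<close> is attained: for the step \<open>|n|\<close> the product has a
  single factor, and \<open>f\<close> is its own root.\<close>

lemma gen_step:
  "0 < gen_step f n" "int (gen_step f n) dvd n" "\<exists>\<beta>. is_skew_root f n t \<beta>"
proof -
  have "0 < nat \<bar>n\<bar> \<and> int (nat \<bar>n\<bar>) dvd n \<and> (\<exists>\<beta>. is_skew_root f n (sgn n * int (nat \<bar>n\<bar>)) \<beta>)"
  proof (intro conjI exI [of _ f])
    show "is_skew_root f n (sgn n * int (nat \<bar>n\<bar>)) f"
      using n monic by (simp add: is_skew_root_def sgn_mult_abs)
  qed (use n in auto)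
  then have "0 < gen_step f n \<and> int (gen_step f n) dvd n \<and>
      (\<exists>\<beta>. is_skew_root f n (sgn n * int (gen_step f n)) \<beta>)"
    unfolding gen_step_def by (rule LeastI)
  then show "0 < gen_step f n" "int (gen_step f n) dvd n" "\<exists>\<beta>. is_skew_root f n t \<beta>"
    by (auto simp: gen_deg_def)
qed

text \<open>Two skew roots of degree \<open>t\<close> both commute with \<open>u\<close>, so they
  are proportional and, being monic, equal. This justifies the \<open>THE\<close>.\<close>

lemma canonical_generator:
  obtains \<beta> where "v = sl_monom \<beta> t" "monic_fract \<beta>" "v ^ m = u" "v * u = u * v"
proof -
  obtain \<beta> where \<beta>: "is_skew_root f n t \<beta>" using gen_step by blast
  note facts = skew_root_commutes [OF gen_step(1,2), folded gen_deg_def]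
    is_skew_root_iff [OF gen_step(1,2), folded gen_deg_def]
  have "(THE \<beta>. is_skew_root f n t \<beta>) = \<beta>"
  proof (rule the_equality)
    fix \<gamma> assume \<gamma>: "is_skew_root f n t \<gamma>"
    then obtain c where "\<gamma> = to_fract [:c:] * \<beta>"
      using proportional [of \<gamma> t \<beta>] facts(1) \<beta> monic_fract_nonzero is_skew_root_def by metis
    then show "\<gamma> = \<beta>" using \<beta> \<gamma> monic_fract_const_mult_eq by (metis is_skew_root_def)
  qed (rule \<beta>)
  then have "v = sl_monom \<beta> t" by (simp add: canonical_generator_def)
  then show thesis using that \<beta> facts by (metis gen_exponent_def)
qed

lemma gen_deg: "int m * t = n" "0 < m" "t \<noteq> 0" "0 < t * n"
proof -
  show *: "int m * t = n" and "0 < m"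
    using signed_divisor [OF n gen_step(2,1)]
    by (simp_all add: gen_exponent_def gen_deg_def mult.commute)
  show "t \<noteq> 0" using * n by auto
  have "t * n = int m * (t * t)" using * by (metis mult.left_commute)
  moreover have "0 < t * t" using \<open>t \<noteq> 0\<close> by (simp add: zero_less_mult_iff neq_iff disj_commute)
  ultimately show "0 < t * n" using \<open>0 < m\<close> by (metis mult_pos_pos of_nat_0_less_iff)
qed

text \<open>
  If \<open>t\<close> did not divide a commuting degree, then normalising a commuting element whose degree is the
  gcd of the two would give a skew root with a smaller step.
\<close>

lemma gen_deg_dvd_commuting_degree:
  assumes "k \<in> commuting_degrees"
  shows "t dvd k"
proof -
  define s where "s = gen_step f n"
  note s = gen_step [folded s_def]
  obtain \<beta> where "v = sl_monom \<beta> t" "monic_fract \<beta>" "v * u = u * v" by (rule canonical_generator)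
  then have "t \<in> commuting_degrees" using commuting_degreesI monic_fract_nonzero by metis
  then have "sgn n * t \<in> commuting_degrees" by (rule commuting_degrees_mult)
  then have "int s \<in> commuting_degrees" using n by (simp add: gen_deg_def s_def flip: mult.assoc)
  then have "gcd k (int s) \<in> commuting_degrees" using assms commuting_degrees_gcd by blast
  moreover define d where "d = nat (gcd k (int s))"
  ultimately have "sgn n * int d \<in> commuting_degrees" by (intro commuting_degrees_mult) simp
  then obtain g where g: "g \<noteq> 0" "sl_monom g (sgn n * int d) * u = u * sl_monom g (sgn n * int d)"
    by (auto simp: commuting_degrees_def)
  have ds: "0 < d" "int d dvd int s" "int d dvd k" using s by (auto simp: d_def)
  then have dn: "int d dvd n" using s by (meson dvd_trans)
  obtain c where c: "monic_fract (to_fract [:c:] * g)" using monic_fract_normalize [OF g(1)] .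
  define \<gamma> where "\<gamma> = to_fract [:c:] * g"
  define N where "N = nat (n div (sgn n * int d))"
  define G where "G = (\<Prod>i<N. sigma (int i * (sgn n * int d)) \<gamma>)"
  have N: "int N * (sgn n * int d) = n"
    using signed_divisor [OF n dn ds(1)] by (simp add: N_def mult.commute)
  have "sl_monom \<gamma> (sgn n * int d) = sl_const c * sl_monom g (sgn n * int d)"
    by (simp add: sl_const_times_monom \<gamma>_def)
  then have "sl_monom \<gamma> (sgn n * int d) * u = u * sl_monom \<gamma> (sgn n * int d)"
    using g(2) by (simp add: commutes_mult sl_const_central)
  then have "sl_monom \<gamma> (sgn n * int d) ^ N * u = u * sl_monom \<gamma> (sgn n * int d) ^ N"
    by (rule power_commuting_commutes)
  then have G: "sl_monom G n * u = u * sl_monom G n"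
    by (simp add: sl_monom_power N flip: G_def)
  \<comment> \<open>\<open>G\<close> and \<open>f\<close> are coefficients of commuting elements of
    the same degree \<open>n\<close>; as both are monic, proportional will mean equal.\<close>
  obtain c' where c': "G = to_fract [:c':] * f"
    using proportional [OF G refl f_nonzero] .
  have "monic_fract G" unfolding G_def
    using c by (intro monic_fract_prod monic_fract_sigma) (simp add: \<gamma>_def)
  then have "G = f" using c' monic monic_fract_const_mult_eq by metis
  then have "is_skew_root f n (sgn n * int d) \<gamma>"
    using c by (simp add: is_skew_root_def \<gamma>_def G_def N_def)
  then have "s \<le> d"
    unfolding s_def gen_step_def using ds dn by (intro Least_le) blast
  then have "s = d" using ds s by (auto dest: zdvd_imp_le)
  then show ?thesis using ds n by (auto simp: gen_deg_def s_def sgn_if)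
qed

text \<open>\<open>t\<close> divides \<open>k\<close>, and the sign condition makes the quotient
  \<open>j\<close> nonnegative. Then \<open>v ^ j\<close> commutes with \<open>u\<close> in the same
  degree, so proportionality applies.\<close>

lemma commuting_monom_is_power:
  assumes g: "g \<noteq> 0" "sl_monom g k * u = u * sl_monom g k" and k: "0 \<le> k * n"
  obtains j c where "k = int j * t" "c \<noteq> 0" "sl_monom g k = sl_const c * v ^ j"
proof -
  have "t dvd k" using g by (intro gen_deg_dvd_commuting_degree commuting_degreesI)
  then obtain j where j: "k = t * j" ..
  then have "0 \<le> (t * n) * j" using k by (simp add: mult_ac)
  then have "0 \<le> j" using gen_deg(4) by (simp add: zero_le_mult_iff)
  then have kj: "k = int (nat j) * t" using j by simp
  obtain \<beta> where \<beta>: "v = sl_monom \<beta> t" "monic_fract \<beta>" "v * u = u * v" by (rule canonical_generator)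
  define h where "h = (\<Prod>i<nat j. sigma (int i * t) \<beta>)"
  have vj: "v ^ nat j = sl_monom h k" by (simp add: \<beta>(1) sl_monom_power kj h_def)
  have "h \<noteq> 0" unfolding h_def using monic_fract_nonzero [OF \<beta>(2)] by simp
  moreover have "sl_monom h k * u = u * sl_monom h k"
    using power_commuting_commutes [OF \<beta>(3)] by (metis vj)
  ultimately obtain c where c: "g = to_fract [:c:] * h" using proportional g by blast
  then have "c \<noteq> 0" using g by auto
  then show thesis using that [OF kj] c by (simp add: vj sl_const_times_monom)
qed

text \<open>
  Otherwise suitable powers of the two elements have opposite degrees; their product is a polynomial
  commuting with \<open>u\<close>, hence a constant, although the factor \<open>Y\<^sup>j\<close> has a coefficient of positive degree.
\<close>

lemma commuting_monom_in_weyl_same_sign: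
  assumes u: "u \<in> weyl" and g: "g \<noteq> 0" "sl_monom g k * u = u * sl_monom g k" "sl_monom g k \<in> weyl"
  shows "0 \<le> k * n"
proof (rule ccontr)
  assume "\<not> 0 \<le> k * n"
  then have neg: "k * n < 0" by simp
  \<comment> \<open>Since \<open>k\<close> and \<open>n\<close> have opposite signs, the powers with
    exponents \<open>|n|\<close> and \<open>|k|\<close> land in degrees \<open>K\<close> and
    \<open>- K\<close>.\<close>
  define K where "K = int (nat \<bar>n\<bar>) * k"
  have K: "int (nat \<bar>k\<bar>) * n = - K" "K \<noteq> 0"
    using neg by (auto simp: K_def mult_less_0_iff)
  define G where "G = (\<Prod>i<nat \<bar>n\<bar>. sigma (int i * k) g)"
  define F where "F = (\<Prod>i<nat \<bar>k\<bar>. sigma (int i * n) f)"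
  have x: "sl_monom g k ^ nat \<bar>n\<bar> = sl_monom G K" by (simp add: sl_monom_power K_def G_def)
  have y: "u ^ nat \<bar>k\<bar> = sl_monom F (- K)" unfolding F_def sl_monom_power K(1) ..
  have nz: "G \<noteq> 0" "F \<noteq> 0" using g f_nonzero by (simp_all add: G_def F_def)
  have "sl_monom G K \<in> weyl" "sl_monom F (- K) \<in> weyl"
    using u g(3) unfolding weyl_def by (auto intro: subalg_power simp flip: x y)
  then obtain a b where a: "G = to_fract (a * wv_coeff K)" and b: "F = to_fract (b * wv_coeff (- K))"
    by (auto simp: sl_monom_in_weyl_iff)
  define p where "p = a * wv_coeff K * shift_poly K (b * wv_coeff (- K))"
  have p: "sl_monom G K * sl_monom F (- K) = sl_monom (to_fract p) 0"
    unfolding sl_monom_mult a b p_def to_fract_mult sigma_mult sigma_to_fract shift_poly_mult by simp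
  have "sl_monom G K * sl_monom F (- K) * u = u * (sl_monom G K * sl_monom F (- K))"
    using g(2) by (intro commutes_mult) (auto intro: power_commuting_commutes simp flip: x y)
  then have "sl_monom (to_fract p) 0 * u = u * sl_monom (to_fract p) 0" by (simp only: p)
  then obtain c where "to_fract p = to_fract [:c:] * 1"
    using proportional [of "to_fract p" 0 1] by (auto simp: sl_monom_1_0)
  then have "degree p = 0" by simp
  moreover have "a \<noteq> 0" "b \<noteq> 0" using nz a b by auto
  then have "degree p = degree a + degree b + nat (- K) + nat K"
    by (simp add: p_def degree_mult_eq degree_wv_coeff)
  ultimately show False using K by simp
qed

text \<open>
  Writing \<open>g X\<^sup>k = (p/q) v\<^sub>k\<close> and \<open>u\<^sup>l = a v\<^sub>n\<^sub>l\<close>, both \<open>q\<close> and \<open>\<sigma>\<^sup>n\<^sup>l(q)\<close> are denominators of the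
  coefficient of \<open>u\<^sup>l g X\<^sup>k = g X\<^sup>k u\<^sup>l\<close>, and these are coprime for all but finitely many \<open>l\<close>.
\<close>

lemma power_times_commuting_monom_in_weyl:
  assumes u: "u \<in> weyl" and g: "sl_monom g k * u = u * sl_monom g k" and k: "0 \<le> k * n"
  obtains l where "u ^ l * sl_monom g k \<in> weyl"
proof -
  obtain p q where h: "g / to_fract (wv_coeff k) = Fract p q" and q: "q \<noteq> 0"
    by (cases "g / to_fract (wv_coeff k)") auto
  then have g_eq: "g = to_fract p / to_fract q * to_fract (wv_coeff k)"
    by (simp add: Fract_conv_to_fract [symmetric] flip: h)
  let ?bad = "{l. \<exists>a. q dvd a * shift_poly l q \<and> \<not> q dvd a}"
  have "inj (\<lambda>l. int l * n)" using n by (auto simp: inj_on_def)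
  then have "infinite (range (\<lambda>l. int l * n))" using finite_imageD infinite_UNIV_nat by blast
  then have "\<not> range (\<lambda>l. int l * n) \<subseteq> ?bad"
    using finite_not_coprime_shift [OF q q] finite_subset by blast
  then obtain l where l: "\<And>a. q dvd a * shift_poly (int l * n) q \<Longrightarrow> q dvd a" by blast
  define K where "K = int l * n"
  obtain F where F: "u ^ l = sl_monom F K" using sl_monom_power K_def by metis
  moreover have "u ^ l \<in> weyl" using u unfolding weyl_def by (rule subalg_power)
  ultimately obtain a where a: "F = to_fract (a * wv_coeff K)"
    by (auto simp: sl_monom_in_weyl_iff)
  have "0 \<le> int l * (k * n)" using k by simp
  \<comment> \<open>No opposite signs, so \<open>wv_coeff_add\<close> applies in both orders and
    produces the common factor \<open>wv_coeff (K + k)\<close>, cancelled below.\<close>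
  then have kK: "0 \<le> k * K" "0 \<le> K * k" by (simp_all add: K_def mult_ac)
  have "sl_monom F K * sl_monom g k = sl_monom g k * sl_monom F K"
    using power_commuting_commutes [OF g [symmetric], of l] by (simp add: F)
  then have "g * sigma k F = F * sigma K g" by (simp add: commutes_monom_iff [symmetric])
  moreover have "g * sigma k F
      = to_fract p / to_fract q * to_fract (shift_poly k a) * to_fract (wv_coeff (K + k))"
    unfolding g_eq a add.commute [of K] wv_coeff_add [OF kK(1)]
    by (simp add: sigma_mult sigma_to_fract)
  moreover have FK: "F * sigma K g
      = to_fract a * (to_fract (shift_poly K p) / to_fract (shift_poly K q)) * to_fract (wv_coeff (K + k))"
    unfolding g_eq a wv_coeff_add [OF kK(2)]
    by (simp add: sigma_mult sigma_divide sigma_to_fract)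
  moreover have "to_fract (wv_coeff (K + k) :: 'a poly) \<noteq> 0" by simp
  ultimately have eq: "to_fract p / to_fract q * to_fract (shift_poly k a)
      = to_fract a * (to_fract (shift_poly K p) / to_fract (shift_poly K q))"
    by (metis mult_right_cancel)
  then have "to_fract (p * shift_poly k a * shift_poly K q) = to_fract (q * (a * shift_poly K p))"
    using q by (simp add: field_simps)
  then have "p * shift_poly k a * shift_poly K q = q * (a * shift_poly K p)"
    by (simp only: to_fract_eq_iff)
  then have "q dvd p * shift_poly k a" using l by (metis dvd_triv_left K_def)
  then obtain b where "p * shift_poly k a = q * b" ..
  then have "to_fract p * to_fract (shift_poly k a) = to_fract q * to_fract b"
    by (simp flip: to_fract_mult)
  then have "to_fract p / to_fract q * to_fract (shift_poly k a) = to_fract b"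
    using q by (simp add: field_simps)
  then have "F * sigma K g = to_fract (b * wv_coeff (K + k))"
    unfolding FK to_fract_mult eq [symmetric] by simp
  then have "u ^ l * sl_monom g k \<in> weyl"
    by (auto simp: F sl_monom_mult sl_monom_in_weyl_iff)
  then show thesis by (rule that)
qed

section \<open>The centralizer in the Weyl algebra\<close>

lemma subalg_u_commutes: "w \<in> subalg {u} \<Longrightarrow> w * u = u * w"
proof (induction rule: subalg.induct)
  case (mult x y)
  then show ?case by (intro commutes_mult)
qed (auto simp: sl_const_central distrib_left distrib_right)

lemma subalg_u_degrees: "w \<in> subalg {u} \<Longrightarrow> sl_coeff w k \<noteq> 0 \<Longrightarrow> n dvd k"
proof (induction arbitrary: k rule: subalg.induct)
  case (gen x)
  then show ?case by (auto simp: sl_coeff_monom split: if_splits)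
next
  case (const c)
  then show ?case by (auto simp: sl_const_def sl_coeff_monom split: if_splits)
next
  case (add x y)
  then show ?case by (metis sl_coeff_add add_0)
next
  case (mult x y)
  have "sl_coeff (x * y) k = (\<Sum>i\<in>{i. sl_coeff x i \<noteq> 0}. sl_coeff x i * sigma i (sl_coeff y (k - i)))"
    by (rule sl_coeff_times) auto
  then obtain i where "sl_coeff x i \<noteq> 0" "sl_coeff y (k - i) \<noteq> 0"
    using mult.prems by (auto elim!: sum.not_neutral_contains_not_neutral)
  then have "n dvd i + (k - i)" using mult.IH by (intro dvd_add)
  then show ?case by simp
qed

text \<open>The \<open>LEAST\<close> is attained: some \<open>u ^ l * v ^ i\<close> lies in the Weyl
  algebra, and it equals \<open>v ^ (m * l + i)\<close>.\<close>

lemma mu_in_weyl: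
  assumes u: "u \<in> weyl"
  shows "v ^ mu v m i \<in> weyl \<and> [mu v m i = i] (mod m)"
proof -
  obtain \<beta> where \<beta>: "v = sl_monom \<beta> t" "v ^ m = u" "v * u = u * v" by (rule canonical_generator)
  obtain g where g: "v ^ i = sl_monom g (int i * t)" by (metis \<beta>(1) sl_monom_power)
  have "sl_monom g (int i * t) * u = u * sl_monom g (int i * t)"
    using power_commuting_commutes [OF \<beta>(3), of i] by (simp only: g)
  moreover have "0 \<le> int i * t * n" using gen_deg(4) by (simp add: mult.assoc)
  ultimately obtain l where "u ^ l * v ^ i \<in> weyl"
    using power_times_commuting_monom_in_weyl [OF u, of g "int i * t"] by (auto simp: g)
  then have "v ^ (m * l + i) \<in> weyl \<and> [m * l + i = i] (mod m)"
    by (simp add: power_add power_mult \<beta>(2) cong_def)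
  then show ?thesis unfolding mu_def by (rule LeastI)
qed

text \<open>By minimality and the congruence, \<open>v ^ j\<close> is a power of \<open>u\<close>
  times the distinguished power in its residue class.\<close>

lemma mu_le:
  assumes "v ^ j \<in> weyl"
  obtains l where "j = m * l + mu v m (j mod m)"
proof -
  have "mu v m (j mod m) \<le> j"
    unfolding mu_def using assms by (intro Least_le) (simp add: cong_def)
  moreover have "[mu v m (j mod m) = j mod m] (mod m)"
    unfolding mu_def by (rule conjunct2 [OF LeastI [of _ j]]) (use assms in \<open>simp add: cong_def\<close>)
  ultimately have "m dvd j - mu v m (j mod m)"
    by (metis cong_def mod_eq_dvd_iff_nat mod_mod_trivial)
  then obtain l where "j - mu v m (j mod m) = m * l" ..
  then show thesis using that [of l] \<open>mu v m (j mod m) \<le> j\<close> by simp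
qed

section \<open>The summands and the decomposition of the centralizer\<close>

definition summand :: "nat \<Rightarrow> 'a skew_laurent set" where
  "summand i = {w * v ^ mu v m i | w. w \<in> subalg {u}}"

lemma summand_sum: "(\<And>k. k \<in> I \<Longrightarrow> g k \<in> summand i) \<Longrightarrow> (\<Sum>k\<in>I. g k) \<in> summand i"
proof -
  assume "\<And>k. k \<in> I \<Longrightarrow> g k \<in> summand i"
  then have "\<forall>k\<in>I. \<exists>w. w \<in> subalg {u} \<and> g k = w * v ^ mu v m i" by (auto simp: summand_def)
  then obtain w where w: "\<And>k. k \<in> I \<Longrightarrow> w k \<in> subalg {u} \<and> g k = w k * v ^ mu v m i"
    by metis
  then have "(\<Sum>k\<in>I. g k) = (\<Sum>k\<in>I. w k) * v ^ mu v m i"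
    by (simp add: sum_distrib_right)
  moreover have "(\<Sum>k\<in>I. w k) \<in> subalg {u}" using w by (intro subalg_sum) blast
  ultimately show ?thesis by (auto simp: summand_def)
qed

lemma summand_subset_centralizer:
  assumes u: "u \<in> weyl"
  shows "summand i \<subseteq> centralizer u weyl"
proof
  fix x assume "x \<in> summand i"
  then obtain w where w: "x = w * v ^ mu v m i" "w \<in> subalg {u}" by (auto simp: summand_def)
  have "v * u = u * v" by (rule canonical_generator)
  then have "v ^ mu v m i * u = u * v ^ mu v m i" by (rule power_commuting_commutes)
  from commutes_mult [OF subalg_u_commutes [OF w(2)] this] have "x * u = u * x"
    by (simp only: w(1))
  moreover have "w \<in> weyl"
    using w(2) u subalg_subset [of "{u}" "{wX, wY}"] by (auto simp: weyl_def)
  then have "x \<in> weyl" using mu_in_weyl [OF u, of i] by (auto simp: w(1) weyl_def intro: subalg.mult)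
  ultimately show "x \<in> centralizer u weyl" by (simp add: centralizer_def)
qed

text \<open>Elements of \<open>K[u]\<close> live in multiples of \<open>m * t\<close>, so a degree
  reveals the index of its summand; the sum is therefore direct.\<close>

lemma summand_degrees:
  assumes u: "u \<in> weyl" and i: "i < m" and x: "x \<in> summand i" "sl_coeff x k \<noteq> 0"
  shows "(k div t) mod int m = int i"
proof -
  obtain w where w: "x = w * v ^ mu v m i" "w \<in> subalg {u}" using x by (auto simp: summand_def)
  obtain \<beta> where "v = sl_monom \<beta> t" by (rule canonical_generator)
  then obtain g where g: "v ^ mu v m i = sl_monom g (int (mu v m i) * t)" by (metis sl_monom_power)
  have "sl_coeff w (k - int (mu v m i) * t) \<noteq> 0"
    using x(2) by (auto simp: w(1) g sl_coeff_times_monom)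
  then have "int m * t dvd k - int (mu v m i) * t"
    using subalg_u_degrees [OF w(2)] by (simp add: gen_deg)
  then obtain l where "k - int (mu v m i) * t = int m * t * l" ..
  then have "k = t * (int m * l + int (mu v m i))" by (simp add: algebra_simps)
  then have "k div t = int m * l + int (mu v m i)" using gen_deg(3) by simp
  then have "(k div t) mod int m = int (mu v m i mod m)" by (simp add: zmod_int)
  also have "\<dots> = int i" using mu_in_weyl [OF u, of i] i by (simp add: cong_def)
  finally show ?thesis .
qed

text \<open>The component is a nonzero scalar times some \<open>v ^ j\<close>. Dividing by the
  scalar puts \<open>v ^ j\<close> into the Weyl algebra, and \<open>mu_le\<close> then rewrites it
  through \<open>u\<close>.\<close>

lemma centralizer_component:
  assumes u: "u \<in> weyl" and w: "w \<in> centralizer u weyl" and k: "sl_coeff w k \<noteq> 0"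
  shows "sl_monom (sl_coeff w k) k \<in> summand (nat (k div t) mod m)"
proof -
  let ?x = "sl_monom (sl_coeff w k) k"
  have weyl: "?x \<in> weyl" using w by (auto simp: centralizer_def intro: weyl_component)
  have comm: "?x * u = u * ?x"
    using w by (intro commutes_monom_component) (simp add: centralizer_def)
  obtain j c where j: "k = int j * t" and c: "c \<noteq> 0" and x: "?x = sl_const c * v ^ j"
    using commuting_monom_is_power [OF k comm] commuting_monom_in_weyl_same_sign [OF u k comm weyl]
    by blast
  have "v ^ j = sl_const (inverse c) * ?x"
    unfolding x using c by (simp add: sl_const_mult sl_const_1 flip: mult.assoc)
  then have "v ^ j \<in> weyl" using weyl by (auto simp: weyl_def intro: subalg.intros)
  then obtain l where l: "j = m * l + mu v m (j mod m)" by (rule mu_le)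
  have "v ^ m = u" by (rule canonical_generator)
  then have "v ^ j = u ^ l * v ^ mu v m (j mod m)"
    by (subst l) (simp add: power_add power_mult)
  then have "?x = (sl_const c * u ^ l) * v ^ mu v m (j mod m)"
    by (simp add: x mult.assoc)
  moreover have "sl_const c * u ^ l \<in> subalg {u}"
    by (intro subalg.mult subalg.const subalg_power subalg.gen) simp
  moreover have "nat (k div t) mod m = j mod m" using gen_deg(3) by (simp add: j)
  ultimately show ?thesis by (auto simp: summand_def)
qed

lemma centralizer_direct_sum:
  assumes u: "u \<in> weyl"
  shows "internal_direct_sum {..<m} summand (centralizer u weyl)"
  unfolding internal_direct_sum_def
proof (intro conjI allI impI ballI set_eqI iffI)
  fix w assume w: "w \<in> centralizer u weyl"
  define S where "S = {k. sl_coeff w k \<noteq> 0}"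
  \<comment> \<open>Homogeneous components are grouped by the residue of their
    \<open>v\<close>-exponent \<open>k div t\<close>.\<close>
  define g where "g i = (\<Sum>k\<in>{k \<in> S. nat (k div t) mod m = i}. sl_monom (sl_coeff w k) k)" for i
  have "(\<Sum>i<m. g i) = (\<Sum>k\<in>S. sl_monom (sl_coeff w k) k)"
    unfolding g_def using gen_deg(2) by (intro sum.group) (auto simp: S_def)
  then have "w = (\<Sum>i<m. g i)" unfolding S_def by (simp flip: sl_monom_decomposition)
  moreover have "g i \<in> summand i" for i
    unfolding g_def by (rule summand_sum) (use centralizer_component [OF u w] in \<open>auto simp: S_def\<close>)
  ultimately show "w \<in> {\<Sum>i<m. g i | g. \<forall>i\<in>{..<m}. g i \<in> summand i}" by blast
next
  fix w assume "w \<in> {\<Sum>i<m. g i | g. \<forall>i\<in>{..<m}. g i \<in> summand i}"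
  then obtain g where w: "w = (\<Sum>i<m. g i)" and "\<forall>i<m. g i \<in> summand i" by auto
  then have g: "g i \<in> weyl" "g i * u = u * g i" if "i < m" for i
    using that summand_subset_centralizer [OF u, of i] by (auto simp: centralizer_def)
  have "w \<in> weyl" unfolding w weyl_def by (rule subalg_sum) (use g in \<open>simp add: weyl_def\<close>)
  moreover have "w * u = u * w" by (simp add: w sum_distrib_left sum_distrib_right g)
  ultimately show "w \<in> centralizer u weyl" by (simp add: centralizer_def)
next
  fix g i assume "(\<forall>i\<in>{..<m}. g i \<in> summand i) \<and> (\<Sum>i<m. g i) = 0" and i: "i \<in> {..<m}"
  then have g: "\<And>i. i < m \<Longrightarrow> g i \<in> summand i" and sum: "(\<Sum>i<m. g i) = 0" by auto
  show "g i = 0"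
  proof (rule sl_eqI, rule ccontr)
    fix k assume "sl_coeff (g i) k \<noteq> sl_coeff 0 k"
    then have k: "sl_coeff (g i) k \<noteq> 0" by simp
    \<comment> \<open>Degree \<open>k\<close> already belongs to summand \<open>i\<close>, so
      nothing can cancel there.\<close>
    have "sl_coeff (g i') k = 0" if "i' < m" "i' \<noteq> i" for i'
      using summand_degrees [OF u _ g, of i' k] summand_degrees [OF u _ g k] that i by auto
    then have "(\<Sum>i'<m. sl_coeff (g i') k) = (\<Sum>i'\<in>{i}. sl_coeff (g i') k)"
      using i by (intro sum.mono_neutral_right) auto
    moreover have "(\<Sum>i'<m. sl_coeff (g i') k) = sl_coeff 0 k" unfolding sum [symmetric] sl_coeff_sum ..
    ultimately show False using k by simp
  qed
qed

end

text \<open>A component of degree \<open>k \<noteq> 0\<close> would force \<open>p\<close> to be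
  fixed by \<open>sigma k\<close>, hence constant. Only degree zero remains, where the Weyl algebra
  is \<open>K[H]\<close>.\<close>

lemma centralizer_hpoly:
  fixes p :: "'a::field_char_0 poly"
  assumes p: "hpoly p \<notin> range sl_const"
  shows "centralizer (hpoly p) weyl = subalg {wH}"
proof (intro set_eqI iffI)
  fix w assume w: "w \<in> centralizer (hpoly p) weyl"
  have "sl_coeff w k = 0" if "k \<noteq> 0" for k
  proof (rule ccontr)
    assume nz: "sl_coeff w k \<noteq> 0"
    have "sl_monom (sl_coeff w k) k * hpoly p = hpoly p * sl_monom (sl_coeff w k) k"
      using w unfolding hpoly_def by (intro commutes_monom_component) (simp add: centralizer_def)
    then have "sl_coeff w k * sigma k (to_fract p) = to_fract p * sl_coeff w k"
      unfolding hpoly_def commutes_monom_iff by simp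
    then have "sigma k (to_fract p) = to_fract p" using nz by (simp add: mult.commute)
    then obtain c where "p = [:c:]"
      using shift_poly_fixed_imp_const [OF _ \<open>k \<noteq> 0\<close>, of p] by (auto simp: sigma_to_fract)
    then show False using p by (auto simp: sl_const_def hpoly_def)
  qed
  then have "w = sl_monom (sl_coeff w 0) 0"
    by (intro sl_eqI) (auto simp: sl_coeff_monom)
  moreover obtain q where "sl_coeff w 0 = to_fract (q * wv_coeff 0)"
    using w in_weyl_imp_graded [of w 0] by (auto simp: centralizer_def)
  ultimately have "w = hpoly q" by (simp add: hpoly_def wv_coeff_def)
  then show "w \<in> subalg {wH}" by (simp add: subalg_wH)
next
  fix w :: "'a skew_laurent" assume "w \<in> subalg {wH}"
  then obtain q where "w = hpoly q" by (auto simp: subalg_wH)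
  then show "w \<in> centralizer (hpoly p) weyl"
    by (simp add: centralizer_def hpoly_in_weyl mult.commute flip: hpoly_mult)
qed

theorem proposition3p1:
  shows "(\<forall>(\<alpha> :: 'a::field_char_0 poly) (n :: int) u f v m.
            n \<noteq> 0 \<and> lead_coeff \<alpha> = 1 \<and> u = hpoly \<alpha> * wv n \<and> f = sl_coeff u n \<and>
            v = canonical_generator f n \<and> m = gen_exponent f n \<longrightarrow>
            internal_direct_sum {..<m} (\<lambda>i. {w * v ^ mu v m i | w. w \<in> subalg {u}})
              (centralizer u weyl))
       \<and> (\<forall>u :: 'a skew_laurent. u \<in> subalg {wH} - range sl_const \<longrightarrow>
            centralizer u weyl = subalg {wH})"
proof (intro conjI allI impI)
  fix \<alpha> :: "'a poly" and n :: int and u f v m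
  assume A: "n \<noteq> 0 \<and> lead_coeff \<alpha> = 1 \<and> u = hpoly \<alpha> * wv n \<and> f = sl_coeff u n \<and>
    v = canonical_generator f n \<and> m = gen_exponent f n"
  then have u: "u = sl_monom (to_fract (\<alpha> * wv_coeff n)) n"
    by (simp add: hpoly_def wv_eq sl_monom_mult)
  then have f: "f = to_fract (\<alpha> * wv_coeff n)" using A by (simp add: sl_coeff_monom)
  interpret monic_homogeneous f n
  proof
    \<comment> \<open>Rewriting \<open>wv n\<close> through \<open>X^n\<close> multiplies \<alpha>
      by a monic polynomial, so the coefficient stays monic.\<close>
    have "lead_coeff (\<alpha> * wv_coeff n) = 1" using A by (simp only: lead_coeff_mult) simp
    then show "monic_fract f" unfolding f by (rule monic_fract_to_fract)
  qed (use A in simp)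
  have "sl_monom f n \<in> weyl" by (auto simp: f sl_monom_in_weyl_iff)
  note sum = centralizer_direct_sum [OF this, unfolded summand_def [abs_def]]
  have eqs: "u = sl_monom f n" "v = canonical_generator f n" "m = gen_exponent f n"
    using A by (simp_all only: u f)
  show "internal_direct_sum {..<m} (\<lambda>i. {w * v ^ mu v m i | w. w \<in> subalg {u}}) (centralizer u weyl)"
    unfolding eqs by (rule sum)
next
  fix u :: "'a skew_laurent"
  assume "u \<in> subalg {wH} - range sl_const"
  then show "centralizer u weyl = subalg {wH}"
    using centralizer_hpoly by (auto simp: subalg_wH)
qed

end
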